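(* Let $\theta\in(0,1]$, $a\in(0,1)$ and $b>1-a$, and let $\mathcal Z=(Z_n)_{n\ge 0}$ be a supercritical Galton-Watson process with one ancestor and offspring law $\mathsf{PF}(\theta,a,b)$, so that its extinction probability $q=1-\big(\frac{1-a}{b}\big)^{1/\theta}$ satisfies $0<q<1$. Let $\mathcal Z_1$ and $\mathcal Z_2$ be the processes counting, in each generation, the individuals of $\mathcal Z$ with finite progeny and with an infinite line of descent, respectively. Then the offspring law of the Galton-Watson process $\mathcal Z_1$, when conditioned upon extinction of $\mathcal Z$, is $$\mathsf{PF}(\theta,q^{-1},a,bq^{\theta}),$$ and the offspring law of the Galton-Watson process $\mathcal Z_2$, when conditioned upon $Z_n\to\infty$, is $\mathsf{PF}_+(\theta,a)$.
   Context: Power-fractional laws: for $\theta\in(0,1]$, $\gamma\ge 1$ and suitable $a,b>0$, $\mathsf{PF}(\theta,\gamma,a,b)$ is the law on $\mathbb{N}_0$ whose probability generating function $f$ satisfies $\frac{1}{(\gamma-f(s))^{\theta}}=\frac{a}{(\gamma-s)^{\theta}}+b$, i.e. $f(s)=\gamma-\big[\frac{a}{(\gamma-s)^{\theta}}+b\big]^{-1/\theta}$, $s\in[0,\gamma)$; the parameter constraints are $a,b>0$, $a+b\ge 1$ if $\gamma=1$, and $a\in(0,1)$, $\gamma^{-\theta}\le\frac{b}{1-a}\le(\gamma-1)^{-\theta}$ if $\gamma>1$. With three parameters, $\mathsf{PF}(\theta,a,b):=\mathsf{PF}(\theta,1,a,b)$, and $\mathsf{PF}_+(\theta,a):=\mathsf{PF}(\theta,a,1-a)$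 for $a\in(0,1)$, a law on $\{1,2,\dots\}$. Decomposition (standard): for a supercritical Galton-Watson process $\mathcal Z$ with one ancestor, offspring generating function $f$ and extinction probability $0<q<1$, conditioned upon extinction of $\mathcal Z$ the process $\mathcal Z_1$ is a subcritical Galton-Watson process with offspring generating function $g(s)=q^{-1}f(qs)$, and conditioned upon $Z_n\to\infty$ the process $\mathcal Z_2$ is a supercritical Galton-Watson process with offspring generating function $h(s)=\frac{f(q+(1-q)s)-q}{1-q}$. *)

theory Defs
  imports "HOL-Probability.Probability"
begin

definition PF_admissible :: "real \<Rightarrow> real \<Rightarrow> real \<Rightarrow> real \<Rightarrow> bool" where
  "PF_admissible \<theta> \<gamma> a b \<longleftrightarrow>
     0 < \<theta> \<and> \<theta> \<le> 1 \<and> 1 \<le> \<gamma> \<and> 0 < a \<and> 0 < b \<and>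
     (\<gamma> = 1 \<longrightarrow> 1 \<le> a + b) \<and>
     (\<gamma> > 1 \<longrightarrow> a < 1 \<and> \<gamma> powr (- \<theta>) \<le> b / (1 - a) \<and> b / (1 - a) \<le> (\<gamma> - 1) powr (- \<theta>))"

(* "p is the power-fractional law PF(\<theta>, \<gamma>, a, b)". A predicate rather than a pmf-valued function:
   for \<gamma> > 1 and b / (1 - a) < (\<gamma> - 1) powr (-\<theta>) the generating function takes a value < 1 at
   s = 1, so that the law has a defect and is not a pmf. A pmf satisfying the predicate is unique,
   being determined by its generating function. *)
definition is_PF :: "real \<Rightarrow> real \<Rightarrow> real \<Rightarrow> real \<Rightarrow> nat pmf \<Rightarrow> bool" where
  "is_PF \<theta> \<gamma> a b p \<longleftrightarrow> PF_admissible \<theta> \<gamma> a b \<and>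
     (\<forall>s. 0 \<le> s \<and> s < \<gamma> \<longrightarrow>
        (\<lambda>k. pmf p k * s ^ k) sums (\<gamma> - (a / (\<gamma> - s) powr \<theta> + b) powr (- 1 / \<theta>)))"

abbreviation is_PF3 :: "real \<Rightarrow> real \<Rightarrow> real \<Rightarrow> nat pmf \<Rightarrow> bool" where
  "is_PF3 \<theta> a b p \<equiv> is_PF \<theta> 1 a b p"

definition is_PF_plus :: "real \<Rightarrow> real \<Rightarrow> nat pmf \<Rightarrow> bool" where
  "is_PF_plus \<theta> a p \<longleftrightarrow> a < 1 \<and> is_PF3 \<theta> a (1 - a) p"

definition supercritical :: "nat pmf \<Rightarrow> bool" where
  "supercritical p \<longleftrightarrow> 1 < (\<integral>\<^sup>+ k. of_nat k \<partial>measure_pmf p)"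

(* Family trees in Ulam-Harris coding: the individual v has c v children v @ [0], v @ [1], ... *)
inductive_set family_tree :: "(nat list \<Rightarrow> nat) \<Rightarrow> nat list set" for c :: "nat list \<Rightarrow> nat" where
  root: "[] \<in> family_tree c"
| child: "v \<in> family_tree c \<Longrightarrow> i < c v \<Longrightarrow> v @ [i] \<in> family_tree c"

definition generation :: "(nat list \<Rightarrow> nat) \<Rightarrow> nat \<Rightarrow> nat list set" where
  "generation c n = {v \<in> family_tree c. length v = n}"

definition finite_progeny :: "(nat list \<Rightarrow> nat) \<Rightarrow> nat list \<Rightarrow> bool" where
  "finite_progeny c v \<longleftrightarrow> finite {w. v @ w \<in> family_tree c}"

definition infinite_line :: "(nat list \<Rightarrow> nat) \<Rightarrow> nat list \<Rightarrow> bool" where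
  "infinite_line c v \<longleftrightarrow> (\<exists>x :: nat \<Rightarrow> nat. \<forall>n. v @ map x [0..<n] \<in> family_tree c)"

(* Generations are finite, so card is the genuine number of individuals in the next three. *)
definition gw_Z :: "(nat list \<Rightarrow> 'w \<Rightarrow> nat) \<Rightarrow> nat \<Rightarrow> 'w \<Rightarrow> nat" where
  "gw_Z \<xi> n \<omega> = card (generation (\<lambda>v. \<xi> v \<omega>) n)"

definition gw_Z1 :: "(nat list \<Rightarrow> 'w \<Rightarrow> nat) \<Rightarrow> nat \<Rightarrow> 'w \<Rightarrow> nat" where
  "gw_Z1 \<xi> n \<omega> = card {v \<in> generation (\<lambda>v. \<xi> v \<omega>) n. finite_progeny (\<lambda>v. \<xi> v \<omega>) v}"

definition gw_Z2 :: "(nat list \<Rightarrow> 'w \<Rightarrow> nat) \<Rightarrow> nat \<Rightarrow> 'w \<Rightarrow> nat" where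
  "gw_Z2 \<xi> n \<omega> = card {v \<in> generation (\<lambda>v. \<xi> v \<omega>) n. infinite_line (\<lambda>v. \<xi> v \<omega>) v}"

definition extinction :: "'w measure \<Rightarrow> (nat list \<Rightarrow> 'w \<Rightarrow> nat) \<Rightarrow> 'w set" where
  "extinction M \<xi> = {\<omega> \<in> space M. \<exists>n. gw_Z \<xi> n \<omega> = 0}"

definition explosion :: "'w measure \<Rightarrow> (nat list \<Rightarrow> 'w \<Rightarrow> nat) \<Rightarrow> 'w set" where
  "explosion M \<xi> = {\<omega> \<in> space M. filterlim (\<lambda>n. gw_Z \<xi> n \<omega>) at_top sequentially}"

(* Offspring numbers \<xi> v of all potential individuals v, i.i.d. with law p *)
definition gw_family :: "'w measure \<Rightarrow> (nat list \<Rightarrow> 'w \<Rightarrow> nat) \<Rightarrow> nat pmf \<Rightarrow> bool" where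
  "gw_family M \<xi> p \<longleftrightarrow> prob_space M \<and>
     prob_space.indep_vars M (\<lambda>_. count_space UNIV) \<xi> UNIV \<and>
     (\<forall>v. distr M (count_space UNIV) (\<xi> v) = measure_pmf p)"

(* Law of the sum of k independent variables with law p *)
definition sum_iid_pmf :: "nat \<Rightarrow> nat pmf \<Rightarrow> nat pmf" where
  "sum_iid_pmf k p = map_pmf sum_list (replicate_pmf k p)"

(* An integer-valued process on N is a Galton-Watson process with one ancestor and offspring law p:
   a Markov chain with Y 0 = 1 almost surely whose transition law out of the state k is that of the
   sum of k i.i.d. variables with law p, expressed through its finite-dimensional distributions. *)
definition galton_watson :: "'w measure \<Rightarrow> (nat \<Rightarrow> 'w \<Rightarrow> nat) \<Rightarrow> nat pmf \<Rightarrow> bool" where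
  "galton_watson N Y p \<longleftrightarrow> prob_space N \<and>
     (\<forall>n. Y n \<in> measurable N (count_space UNIV)) \<and>
     (\<forall>n (y :: nat \<Rightarrow> nat).
        measure N {\<omega> \<in> space N. \<forall>i\<le>n. Y i \<omega> = y i} =
        (if y 0 = 1 then 1 else 0) * (\<Prod>i<n. pmf (sum_iid_pmf (y i) p) (y (Suc i))))"

end

theory Submission
  imports Defs
begin

text \<open>Everything rests on the branching property: given the number of children of the root, the
  subtrees of the children are independent copies of the whole tree. Hence the law of a functional
  of the tree that is built from its values on these subtrees satisfies a recursion among pmfs.
  By Koenig's lemma an individual has an infinite line of descent iff its subtree is infinite.
  Marking each child of the root as surviving with probability \<open>1 - q\<close> splits the offspring
  law into ``no survivor'', which has probability \<open>f q = q\<close>, and the law with generating function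
  \<open>(f (q + (1 - q) s) - q) / (1 - q)\<close>. Requiring extinction of the subtrees of all children weights
  \<open>p k\<close> with \<open>q ^ k\<close>, which yields the generating function \<open>f (q s) / q\<close>. Induction on the
  generation turns both observations into laws of whole paths.\<close>

section \<open>Family trees\<close>

text \<open>Whether an individual counts in \<open>gw_Z1\<close> or \<open>gw_Z2\<close> depends on
  its whole future, so generation \<open>n\<close> is not a function of the first \<open>n\<close>
  generations of offspring numbers. Induction from generation \<open>n\<close> to its children is
  therefore awkward; decomposing at the root works, since the defining property concerns only the
  subtree below an individual.

  The two conditionings behave differently. Survival of the root is entry 0 of the path of
  \<open>gw_Z2\<close>, so an unconditioned path law already contains it; what remains is that
  explosion and survival agree almost surely. Extinction cannot be read off finitely many generation
  sizes, so finiteness of the tree travels through the induction as a flag; on that event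
  \<open>gw_Z1\<close> is the whole population.

  The parameters come from one change of variable: for \<open>x = (1 - s) powr (- \<theta>)\<close>
  the offspring generating function is \<open>x \<mapsto> a * x + b\<close>, and \<open>q\<close>
  corresponds to its fixed point \<open>b / (1 - a)\<close>. Rescaling \<open>s\<close> at 0 by
  \<open>q\<close>, or at 1 by \<open>1 - q\<close>, keeps the slope \<open>a\<close> and changes
  only the other parameters.\<close>

lemma append_in_family_tree_iff:
  "v @ w \<in> family_tree c \<longleftrightarrow> v \<in> family_tree c \<and> w \<in> family_tree (\<lambda>u. c (v @ u))"
proof (induction w rule: rev_induct)
  case Nil
  show ?case by (auto intro: family_tree.root)
next
  case (snoc i w)
  have *: "u @ [i] \<in> family_tree c' \<longleftrightarrow> u \<in> family_tree c' \<and> i < c' u" for u c'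
    by (subst family_tree.simps) auto
  show ?case
    using snoc *[of "v @ w" c] *[of w "\<lambda>u. c (v @ u)"] by auto
qed

lemma Cons_in_family_tree_iff:
  "i # v \<in> family_tree c \<longleftrightarrow> i < c [] \<and> v \<in> family_tree (\<lambda>w. c (i # w))"
proof -
  have "[i] \<in> family_tree c \<longleftrightarrow> i < c []"
    by (subst family_tree.simps) (auto intro: family_tree.root)
  then show ?thesis
    using append_in_family_tree_iff[of "[i]" v c] by simp
qed

lemma family_tree_rec:
  "family_tree c = insert [] (\<Union>i<c []. (#) i ` family_tree (\<lambda>w. c (i # w)))"
proof (rule set_eqI)
  fix v
  show "v \<in> family_tree c \<longleftrightarrow> v \<in> insert [] (\<Union>i<c []. (#) i ` family_tree (\<lambda>w. c (i # w)))"
    by (cases v) (auto simp: Cons_in_family_tree_iff intro: family_tree.root)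
qed

text \<open>Pigeonhole step of Koenig's argument: apart from the root, the tree is a union of
  finitely many shifted child subtrees. It also makes survival of the root a function of the
  survival of its children.\<close>

lemma infinite_family_tree_iff:
  "infinite (family_tree c) \<longleftrightarrow> (\<exists>i<c []. infinite (family_tree (\<lambda>w. c (i # w))))"
  by (subst family_tree_rec) (auto simp: finite_image_iff)

lemma generation_0: "generation c 0 = {[]}"
  by (auto simp: generation_def intro: family_tree.root)

lemma generation_Suc:
  "generation c (Suc n) = (\<Union>i<c []. (#) i ` generation (\<lambda>w. c (i # w)) n)"
proof (rule set_eqI)
  fix v
  show "v \<in> generation c (Suc n) \<longleftrightarrow> v \<in> (\<Union>i<c []. (#) i ` generation (\<lambda>w. c (i # w)) n)"
    by (cases v) (auto simp: generation_def Cons_in_family_tree_iff)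
qed

lemma finite_generation: "finite (generation c n)"
  by (induction n arbitrary: c) (simp_all add: generation_0 generation_Suc)

lemma generation_empty_mono:
  assumes "generation c n = {}" "n \<le> m"
  shows "generation c m = {}"
proof (rule ccontr)
  assume "generation c m \<noteq> {}"
  then obtain v where v: "v \<in> family_tree c" "length v = m"
    by (auto simp: generation_def)
  have "take n v \<in> generation c n"
    using v assms(2) append_in_family_tree_iff[of "take n v" "drop n v" c]
    by (auto simp: generation_def)
  then show False using assms(1) by simp
qed

text \<open>Generations are finite and an empty one is followed only by empty ones. This writes
  finiteness of the tree as a countable union of conditions on generations, the source of its
  measurability and of the extinction probability.\<close>

lemma finite_family_tree_iff: "finite (family_tree c) \<longleftrightarrow> (\<exists>n. generation c n = {})"
proof
  assume "finite (family_tree c)"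
  then have "\<forall>v\<in>family_tree c. length v \<le> Max (length ` family_tree c)"
    by simp
  then have "generation c (Suc (Max (length ` family_tree c))) = {}"
    by (force simp: generation_def)
  then show "\<exists>n. generation c n = {}" ..
next
  assume "\<exists>n. generation c n = {}"
  then obtain n where n: "generation c n = {}" ..
  have "family_tree c \<subseteq> (\<Union>k<n. generation c k)"
  proof
    fix v assume v: "v \<in> family_tree c"
    then have "v \<in> generation c (length v)" by (simp add: generation_def)
    then have "length v < n"
      using generation_empty_mono[OF n, of "length v"] by (cases "n \<le> length v") auto
    with v show "v \<in> (\<Union>k<n. generation c k)" by (simp add: generation_def)
  qed
  then show "finite (family_tree c)"
    by (rule finite_subset) (simp add: finite_generation)
qed

lemma finite_progeny_iff:
  assumes "v \<in> family_tree c"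
  shows "finite_progeny c v \<longleftrightarrow> finite (family_tree (\<lambda>w. c (v @ w)))"
  using assms by (simp add: finite_progeny_def append_in_family_tree_iff)

lemma infinite_line_iff:
  assumes v: "v \<in> family_tree c"
  shows "infinite_line c v \<longleftrightarrow> infinite (family_tree (\<lambda>w. c (v @ w)))"
proof
  assume "infinite_line c v"
  then obtain x where x: "\<And>n. v @ map x [0..<n] \<in> family_tree c"
    by (auto simp: infinite_line_def)
  have "map x [0..<n] \<in> generation (\<lambda>w. c (v @ w)) n" for n
    using x[of n] by (simp add: generation_def append_in_family_tree_iff)
  then show "infinite (family_tree (\<lambda>w. c (v @ w)))"
    by (auto simp: finite_family_tree_iff)
next
  assume inf: "infinite (family_tree (\<lambda>w. c (v @ w)))"
  \<comment> \<open>Invariant of the choice: the word reaches an individual \<open>n\<close> levels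
    below \<open>v\<close> whose subtree is still infinite, so one more child can always be
    chosen.\<close>
  let ?P = "\<lambda>n u. length u = n \<and> v @ u \<in> family_tree c \<and> infinite (family_tree (\<lambda>w. c (v @ u @ w)))"
  have "\<exists>f. \<forall>n. ?P n (f n) \<and> (\<exists>i. f (Suc n) = f n @ [i])"
  proof (rule dependent_nat_choice)
    show "\<exists>u. ?P 0 u" using inf v by auto
  next
    fix u n assume u: "?P n u"
    then obtain i where i: "i < c (v @ u)" "infinite (family_tree (\<lambda>w. c (v @ u @ i # w)))"
      using infinite_family_tree_iff[of "\<lambda>w. c (v @ u @ w)"] by auto
    then have "?P (Suc n) (u @ [i]) \<and> (\<exists>j. u @ [i] = u @ [j])"
      using u family_tree.child[of "v @ u" c i] by simp
    then show "\<exists>u'. ?P (Suc n) u' \<and> (\<exists>i. u' = u @ [i])" by blast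
  qed
  then obtain f where f: "\<And>n. ?P n (f n)" "\<And>n. \<exists>i. f (Suc n) = f n @ [i]" by blast
  \<comment> \<open>Each chosen word extends the previous one by a single letter, so the last
    letters form one sequence having all the words as prefixes.\<close>
  have path: "f n = map (\<lambda>k. last (f (Suc k))) [0..<n]" for n
  proof (induction n)
    case 0
    show ?case using f(1)[of 0] by simp
  next
    case (Suc n)
    obtain i where "f (Suc n) = f n @ [i]" using f(2) by blast
    then show ?case using Suc by simp
  qed
  show "infinite_line c v"
    unfolding infinite_line_def
  proof (intro exI allI)
    fix n
    show "v @ map (\<lambda>k. last (f (Suc k))) [0..<n] \<in> family_tree c"
      using f(1)[of n] path[of n] by simp
  qed
qed

section \<open>Laws of tree functionals\<close>

text \<open>Common form of \<open>gw_Z\<close>, \<open>gw_Z1\<close> and \<open>gw_Z2\<close>. The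
  type \<open>\<phi>\<close> sees only the subtree below the individual, so the same functional
  reappears on the subtrees of the root's children.\<close>

definition typed_count :: "((nat list \<Rightarrow> nat) \<Rightarrow> bool) \<Rightarrow> nat \<Rightarrow> (nat list \<Rightarrow> nat) \<Rightarrow> nat" where
  "typed_count \<phi> n c = card {v \<in> generation c n. \<phi> (\<lambda>w. c (v @ w))}"

lemma typed_count_0: "typed_count \<phi> 0 c = of_bool (\<phi> c)"
  by (simp add: typed_count_def generation_0 Collect_conv_if)

lemma typed_count_Suc:
  "typed_count \<phi> (Suc n) c = (\<Sum>i<c []. typed_count \<phi> n (\<lambda>w. c (i # w)))"
proof -
  let ?A = "\<lambda>i. {v \<in> generation (\<lambda>w. c (i # w)) n. \<phi> (\<lambda>w. c (i # v @ w))}"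
  have "{v \<in> generation c (Suc n). \<phi> (\<lambda>w. c (v @ w))} = (\<Union>i<c []. (#) i ` ?A i)"
    by (auto simp: generation_Suc)
  moreover have "card (\<Union>i<c []. (#) i ` ?A i) = (\<Sum>i<c []. card ((#) i ` ?A i))"
    by (rule card_UN_disjoint) (auto simp: finite_generation)
  moreover have "card ((#) i ` ?A i) = typed_count \<phi> n (\<lambda>w. c (i # w))" for i
    by (simp add: typed_count_def card_image)
  ultimately show ?thesis by (simp add: typed_count_def)
qed

abbreviation total_count :: "nat \<Rightarrow> (nat list \<Rightarrow> nat) \<Rightarrow> nat" where
  "total_count \<equiv> typed_count (\<lambda>_. True)"

lemma total_count_eq_0_iff: "total_count n c = 0 \<longleftrightarrow> generation c n = {}"
  by (simp add: typed_count_def finite_generation)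

lemma finite_family_tree_iff_count: "finite (family_tree c) \<longleftrightarrow> (\<exists>n. total_count n c = 0)"
  by (simp add: finite_family_tree_iff total_count_eq_0_iff)

lemma gw_Z_eq: "gw_Z \<xi> n \<omega> = total_count n (\<lambda>v. \<xi> v \<omega>)"
  by (simp add: gw_Z_def typed_count_def)

lemma gw_Z1_eq: "gw_Z1 \<xi> n \<omega> = typed_count (\<lambda>c. finite (family_tree c)) n (\<lambda>v. \<xi> v \<omega>)"
  unfolding gw_Z1_def typed_count_def
  by (intro arg_cong[where f = card] Collect_cong conj_cong refl finite_progeny_iff)
     (simp add: generation_def)

lemma gw_Z2_eq: "gw_Z2 \<xi> n \<omega> = typed_count (\<lambda>c. infinite (family_tree c)) n (\<lambda>v. \<xi> v \<omega>)"
  unfolding gw_Z2_def typed_count_def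
  by (intro arg_cong[where f = card] Collect_cong conj_cong refl infinite_line_iff)
     (simp add: generation_def)

text \<open>In a finite tree every individual has finite progeny. Hence on extinction the path of
  \<open>gw_Z1\<close> can be replaced by that of the total population.\<close>

lemma typed_count_finite_tree:
  assumes "finite (family_tree c)"
  shows "typed_count (\<lambda>c. finite (family_tree c)) n c = total_count n c"
proof -
  have "finite (family_tree (\<lambda>w. c (v @ w)))" if "v \<in> generation c n" for v
  proof -
    have "finite_progeny c v"
      using finite_vimageI[OF assms, of "(@) v"] by (simp add: finite_progeny_def vimage_def inj_on_def)
    with that show ?thesis by (simp add: finite_progeny_iff generation_def)
  qed
  then show ?thesis unfolding typed_count_def
    by (intro arg_cong[where f = card]) auto
qed

section \<open>Measurability and laws of functionals of the offspring family\<close>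

abbreviation tree_space :: "(nat list \<Rightarrow> nat) measure" where
  "tree_space \<equiv> PiM UNIV (\<lambda>_. count_space UNIV)"

lemma measurable_offspring [measurable]: "(\<lambda>c. c v) \<in> tree_space \<rightarrow>\<^sub>M count_space UNIV"
  by (rule measurable_component_singleton) simp

lemma measurable_subtree: "(\<lambda>c w. c (i # w)) \<in> tree_space \<rightarrow>\<^sub>M tree_space"
  by (rule measurable_PiM_single') (auto simp: measurable_offspring)

lemma measurable_typed_count:
  assumes \<phi>: "Measurable.pred tree_space \<phi>"
  shows "typed_count \<phi> n \<in> tree_space \<rightarrow>\<^sub>M count_space UNIV"
proof (induction n)
  case 0
  show ?case unfolding typed_count_0[abs_def]
    by (rule measurable_compose[OF \<phi> measurable_count_space])
next
  case (Suc n)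
  \<comment> \<open>The number of summands is itself random; it is frozen at \<open>k\<close> here,
    and \<open>c []\<close> takes only countably many values.\<close>
  have *: "(\<lambda>c. \<Sum>i<k. typed_count \<phi> n (\<lambda>w. c (i # w))) \<in> tree_space \<rightarrow>\<^sub>M count_space UNIV" for k
  proof (induction k)
    case (Suc k)
    have "(\<lambda>c. x + typed_count \<phi> n (\<lambda>w. c (k # w))) \<in> tree_space \<rightarrow>\<^sub>M count_space UNIV" for x
      by (rule measurable_compose[OF measurable_compose[OF measurable_subtree \<open>typed_count \<phi> n \<in> _\<close>]
          measurable_count_space])
    from measurable_compose_countable[OF this Suc] show ?case by (simp only: sum.lessThan_Suc)
  qed simp
  show ?case unfolding typed_count_Suc[abs_def]
    by (rule measurable_compose_countable[OF * measurable_offspring])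
qed

lemma measurable_total_count [measurable]: "total_count n \<in> tree_space \<rightarrow>\<^sub>M count_space UNIV"
  by (rule measurable_typed_count) simp

lemma pred_finite_family_tree [measurable]: "Measurable.pred tree_space (\<lambda>c. finite (family_tree c))"
  unfolding finite_family_tree_iff_count by measurable

lemma pred_infinite_family_tree [measurable]: "Measurable.pred tree_space (\<lambda>c. infinite (family_tree c))"
  unfolding finite_family_tree_iff_count by measurable

text \<open>The quantification over all families \<open>\<xi>\<close> makes the notion applicable to the subtrees of
  the children of the root.\<close>
definition gw_law :: "'w measure \<Rightarrow> nat pmf \<Rightarrow> ((nat list \<Rightarrow> nat) \<Rightarrow> 'a) \<Rightarrow> 'a pmf \<Rightarrow> bool" where
  "gw_law M p W L \<longleftrightarrow> W \<in> tree_space \<rightarrow>\<^sub>M count_space UNIV \<and>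
     (\<forall>\<xi>. gw_family M \<xi> p \<longrightarrow>
        distr M (count_space UNIV) (\<lambda>\<omega>. W (\<lambda>v. \<xi> v \<omega>)) = measure_pmf L)"

lemma gw_family_measurable:
  assumes "gw_family M \<xi> p"
  shows "(\<lambda>\<omega> v. \<xi> v \<omega>) \<in> M \<rightarrow>\<^sub>M tree_space"
proof -
  interpret prob_space M using assms by (simp add: gw_family_def)
  show ?thesis
    using assms by (intro measurable_PiM_single') (auto simp: gw_family_def indep_vars_def)
qed

lemma gw_family_subtree:
  assumes "gw_family M \<xi> p"
  shows "gw_family M (\<lambda>v. \<xi> (i # v)) p"
proof -
  interpret prob_space M using assms by (simp add: gw_family_def)
  \<comment> \<open>Grouping into the disjoint singleton blocks \<open>{i # v}\<close> amounts to
    reindexing along the injective map \<open>v \<mapsto> i # v\<close>.\<close>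
  have "indep_vars (\<lambda>v. PiM {i # v} (\<lambda>_. count_space UNIV)) (\<lambda>v \<omega>. restrict (\<lambda>u. \<xi> u \<omega>) {i # v}) UNIV"
    by (rule indep_vars_restrict[where I = UNIV])
       (use assms in \<open>auto simp: gw_family_def disjoint_family_on_def\<close>)
  then have "indep_vars (\<lambda>_. count_space UNIV) (\<lambda>v \<omega>. restrict (\<lambda>u. \<xi> u \<omega>) {i # v} (i # v)) UNIV"
    by (rule indep_vars_compose2) (rule measurable_component_singleton, simp)
  then have "indep_vars (\<lambda>_. count_space UNIV) (\<lambda>v. \<xi> (i # v)) UNIV" by simp
  then show ?thesis using assms by (simp add: gw_family_def prob_space_axioms)
qed

lemma gw_law_map:
  assumes "gw_law M p W L"
  shows "gw_law M p (\<lambda>c. h (W c)) (map_pmf h L)"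
  unfolding gw_law_def
proof (intro conjI allI impI)
  have W: "W \<in> tree_space \<rightarrow>\<^sub>M count_space UNIV" using assms by (simp add: gw_law_def)
  then show "(\<lambda>c. h (W c)) \<in> tree_space \<rightarrow>\<^sub>M count_space UNIV"
    by (rule measurable_compose[OF _ measurable_count_space])
  fix \<xi> assume \<xi>: "gw_family M \<xi> p"
  have "(\<lambda>\<omega>. W (\<lambda>v. \<xi> v \<omega>)) \<in> M \<rightarrow>\<^sub>M count_space UNIV"
    by (rule measurable_compose[OF gw_family_measurable[OF \<xi>] W])
  then have "distr M (count_space UNIV) (\<lambda>\<omega>. h (W (\<lambda>v. \<xi> v \<omega>)))
      = distr (distr M (count_space UNIV) (\<lambda>\<omega>. W (\<lambda>v. \<xi> v \<omega>))) (count_space UNIV) h"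
    by (subst distr_distr) (simp_all add: comp_def)
  also have "\<dots> = measure_pmf (map_pmf h L)"
    using assms \<xi> by (simp add: gw_law_def map_pmf_rep_eq)
  finally show "distr M (count_space UNIV) (\<lambda>\<omega>. h (W (\<lambda>v. \<xi> v \<omega>))) = measure_pmf (map_pmf h L)" .
qed

lemma gw_law_measure:
  assumes "gw_law M p W L" "gw_family M \<xi> p"
  shows "measure M {\<omega> \<in> space M. W (\<lambda>v. \<xi> v \<omega>) \<in> A} = measure L A"
proof -
  have "(\<lambda>\<omega>. W (\<lambda>v. \<xi> v \<omega>)) \<in> M \<rightarrow>\<^sub>M count_space UNIV"
    using assms by (auto simp: gw_law_def intro: measurable_compose[OF gw_family_measurable])
  then have "measure (distr M (count_space UNIV) (\<lambda>\<omega>. W (\<lambda>v. \<xi> v \<omega>))) A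
     = measure M ((\<lambda>\<omega>. W (\<lambda>v. \<xi> v \<omega>)) -` A \<inter> space M)"
    by (subst measure_distr) simp_all
  moreover have "(\<lambda>\<omega>. W (\<lambda>v. \<xi> v \<omega>)) -` A \<inter> space M = {\<omega> \<in> space M. W (\<lambda>v. \<xi> v \<omega>) \<in> A}"
    by auto
  ultimately show ?thesis using assms by (simp add: gw_law_def)
qed

lemma gw_law_measure_singleton:
  assumes "gw_law M p W L" "gw_family M \<xi> p"
  shows "measure M {\<omega> \<in> space M. W (\<lambda>v. \<xi> v \<omega>) = x} = pmf L x"
  using gw_law_measure[OF assms, of "{x}"] by (simp add: measure_pmf_single)

lemma gw_lawI:
  fixes W :: "(nat list \<Rightarrow> nat) \<Rightarrow> 'a :: countable"
  assumes W: "W \<in> tree_space \<rightarrow>\<^sub>M count_space UNIV"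
    and "\<And>\<xi> x. gw_family M \<xi> p \<Longrightarrow> measure M {\<omega> \<in> space M. W (\<lambda>v. \<xi> v \<omega>) = x} = pmf L x"
  shows "gw_law M p W L"
  unfolding gw_law_def
proof (intro conjI allI impI)
  fix \<xi> assume \<xi>: "gw_family M \<xi> p"
  interpret prob_space M using \<xi> by (simp add: gw_family_def)
  have m: "(\<lambda>\<omega>. W (\<lambda>v. \<xi> v \<omega>)) \<in> M \<rightarrow>\<^sub>M count_space UNIV"
    by (rule measurable_compose[OF gw_family_measurable[OF \<xi>] W])
  show "distr M (count_space UNIV) (\<lambda>\<omega>. W (\<lambda>v. \<xi> v \<omega>)) = measure_pmf L"
  proof (rule measure_eqI_countable[where A = UNIV])
    fix x
    have "(\<lambda>\<omega>. W (\<lambda>v. \<xi> v \<omega>)) -` {x} \<inter> space M = {\<omega> \<in> space M. W (\<lambda>v. \<xi> v \<omega>) = x}"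
      by auto
    then show "emeasure (distr M (count_space UNIV) (\<lambda>\<omega>. W (\<lambda>v. \<xi> v \<omega>))) {x} = emeasure L {x}"
      using m assms(2)[OF \<xi>, of x]
      by (subst emeasure_distr) (simp_all add: emeasure_eq_measure emeasure_pmf_single)
  qed auto
qed (rule W)

lemma pmf_replicate_pmf:
  "pmf (replicate_pmf k L) xs = (if length xs = k then \<Prod>i<k. pmf L (xs ! i) else 0)"
proof (induction k arbitrary: xs)
  case 0
  then show ?case by (auto simp: indicator_def)
next
  case (Suc k)
  have eq: "replicate_pmf (Suc k) L = map_pmf (\<lambda>(x, xs). x # xs) (pair_pmf L (replicate_pmf k L))"
    by (simp add: pair_pmf_def map_bind_pmf map_pmf_def bind_assoc_pmf bind_return_pmf)
  show ?case
  proof (cases xs)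
    case Nil
    then have "xs \<notin> set_pmf (replicate_pmf (Suc k) L)" by (simp only: set_replicate_pmf) auto
    then show ?thesis using Nil by (simp add: set_pmf_iff del: replicate_pmf.simps)
  next
    case (Cons y ys)
    have "pmf (replicate_pmf (Suc k) L) ((\<lambda>(x, xs). x # xs) (y, ys)) = pmf (pair_pmf L (replicate_pmf k L)) (y, ys)"
      unfolding eq by (rule pmf_map_inj') (auto simp: inj_on_def)
    then show ?thesis using Suc Cons by (simp add: pmf_pair prod.lessThan_Suc_shift del: replicate_pmf.simps prod.lessThan_Suc)
  qed
qed

text \<open>The root's offspring number and the subtrees of its potential children use disjoint
  blocks of coordinates, hence are independent. In the list of values the number of children is the
  length, so a single functional carries all the information for a recursion.\<close>

lemma gw_law_branch:
  fixes W :: "(nat list \<Rightarrow> nat) \<Rightarrow> 'a :: countable"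
  assumes L: "gw_law M p W L"
  shows "gw_law M p (\<lambda>c. map (\<lambda>i. W (\<lambda>w. c (i # w))) [0..<c []])
           (bind_pmf p (\<lambda>k. replicate_pmf k L))"
proof (rule gw_lawI)
  have W: "W \<in> tree_space \<rightarrow>\<^sub>M count_space UNIV" using L by (simp add: gw_law_def)
  have Wi [measurable]: "(\<lambda>c. W (\<lambda>w. c (i # w))) \<in> tree_space \<rightarrow>\<^sub>M count_space UNIV" for i
    by (rule measurable_compose[OF measurable_subtree W])
  have *: "(\<lambda>c. map (\<lambda>i. W (\<lambda>w. c (i # w))) js) \<in> tree_space \<rightarrow>\<^sub>M count_space UNIV" for js
  proof (induction js)
    case (Cons j js)
    have "(\<lambda>c. x # map (\<lambda>i. W (\<lambda>w. c (i # w))) js) \<in> tree_space \<rightarrow>\<^sub>M count_space UNIV" for x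
      by (rule measurable_compose[OF Cons measurable_count_space])
    from measurable_compose_countable[OF this Wi] show ?case by (simp only: list.map)
  qed simp
  show "(\<lambda>c. map (\<lambda>i. W (\<lambda>w. c (i # w))) [0..<c []]) \<in> tree_space \<rightarrow>\<^sub>M count_space UNIV"
    by (rule measurable_compose_countable[where f = "\<lambda>k c. map (\<lambda>i. W (\<lambda>w. c (i # w))) [0..<k]"
        and g = "\<lambda>c. c []"]) (auto intro: *)
  fix \<xi> xs
  assume \<xi>: "gw_family M \<xi> p"
  interpret prob_space M using \<xi> by (simp add: gw_family_def)
  \<comment> \<open>Block 0 is the root and block \<open>Suc i\<close> consists of child
    \<open>i\<close> with all its potential descendants. \<open>Y\<close> is the condition that
    \<open>xs\<close> imposes on each block.\<close>
  define K where "K j = (case j of 0 \<Rightarrow> {[]} | Suc i \<Rightarrow> range ((#) i))" for j :: nat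
  define Y where "Y j c = (case j of 0 \<Rightarrow> c [] = length xs | Suc i \<Rightarrow> W (\<lambda>w. c (i # w)) = xs ! i)"
    for j and c :: "nat list \<Rightarrow> nat"
  have "indep_vars (\<lambda>j. PiM (K j) (\<lambda>_. count_space UNIV)) (\<lambda>j \<omega>. restrict (\<lambda>v. \<xi> v \<omega>) (K j)) UNIV"
    by (rule indep_vars_restrict[where I = UNIV])
       (use \<xi> in \<open>auto simp: gw_family_def disjoint_family_on_def K_def split: nat.splits\<close>)
  then have "indep_vars (\<lambda>_. count_space UNIV) (\<lambda>j \<omega>. Y j (restrict (\<lambda>v. \<xi> v \<omega>) (K j))) UNIV"
  proof (rule indep_vars_compose2)
    fix j
    show "Y j \<in> PiM (K j) (\<lambda>_. count_space UNIV) \<rightarrow>\<^sub>M count_space UNIV"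
    proof (cases j)
      case 0
      have "(\<lambda>c. c []) \<in> PiM (K 0) (\<lambda>_. count_space UNIV) \<rightarrow>\<^sub>M count_space (UNIV :: nat set)"
        by (rule measurable_component_singleton) (simp add: K_def)
      from measurable_compose[OF this measurable_count_space] show ?thesis
        unfolding 0 Y_def by simp
    next
      case (Suc i)
      have "(\<lambda>c w. c (i # w)) \<in> PiM (K (Suc i)) (\<lambda>_. count_space UNIV) \<rightarrow>\<^sub>M tree_space"
        by (rule measurable_PiM_single') (auto simp: K_def intro!: measurable_component_singleton)
      from measurable_compose[OF measurable_compose[OF this W] measurable_count_space]
      show ?thesis unfolding Suc Y_def by simp
    qed
  qed
  also have "(\<lambda>j \<omega>. Y j (restrict (\<lambda>v. \<xi> v \<omega>) (K j))) = (\<lambda>j \<omega>. Y j (\<lambda>v. \<xi> v \<omega>))"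
    by (auto simp: Y_def K_def fun_eq_iff split: nat.splits)
  finally have ind: "indep_vars (\<lambda>_. count_space UNIV) (\<lambda>j \<omega>. Y j (\<lambda>v. \<xi> v \<omega>)) UNIV" .
  let ?n = "length xs"
  let ?E = "\<lambda>j. {\<omega> \<in> space M. Y j (\<lambda>v. \<xi> v \<omega>)}"
  have "{\<omega> \<in> space M. map (\<lambda>i. W (\<lambda>w. \<xi> (i # w) \<omega>)) [0..<\<xi> [] \<omega>] = xs}
      = {\<omega> \<in> space M. \<xi> [] \<omega> = ?n \<and> (\<forall>i<?n. W (\<lambda>w. \<xi> (i # w) \<omega>) = xs ! i)}"
    by (auto simp: list_eq_iff_nth_eq)
  also have "\<dots> = (\<Inter>j<Suc ?n. (\<lambda>\<omega>. Y j (\<lambda>v. \<xi> v \<omega>)) -` {True} \<inter> space M)"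
    by (auto simp: Y_def lessThan_Suc_eq_insert_0 split: nat.splits)
  finally have "prob {\<omega> \<in> space M. map (\<lambda>i. W (\<lambda>w. \<xi> (i # w) \<omega>)) [0..<\<xi> [] \<omega>] = xs}
      = (\<Prod>j<Suc ?n. prob ((\<lambda>\<omega>. Y j (\<lambda>v. \<xi> v \<omega>)) -` {True} \<inter> space M))"
    using indep_varsD[OF ind, of "{..<Suc ?n}" "\<lambda>_. {True}"] by (metis (no_types, lifting)
      Zero_not_Suc bot_nat_0.extremum_strict empty_iff finite_lessThan iso_tuple_UNIV_I lessThan_iff
      sets_count_space Pow_UNIV subset_UNIV zero_less_Suc)
  also have "\<dots> = (\<Prod>j<Suc ?n. prob (?E j))"
    by (intro prod.cong arg_cong[where f = prob]) auto
  also have "\<dots> = prob (?E 0) * (\<Prod>i<?n. prob (?E (Suc i)))"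
    by (rule prod.lessThan_Suc_shift)
  also have "prob (?E 0) = pmf p ?n"
  proof -
    have "\<xi> [] \<in> M \<rightarrow>\<^sub>M count_space UNIV" using \<xi> by (auto simp: gw_family_def indep_vars_def)
    then have "measure (distr M (count_space UNIV) (\<xi> [])) {?n} = prob (\<xi> [] -` {?n} \<inter> space M)"
      by (subst measure_distr) simp_all
    moreover have "\<xi> [] -` {?n} \<inter> space M = ?E 0" by (auto simp: Y_def)
    ultimately show ?thesis using \<xi> by (simp add: gw_family_def measure_pmf_single)
  qed
  also have "(\<Prod>i<?n. prob (?E (Suc i))) = (\<Prod>i<?n. pmf L (xs ! i))"
    using gw_law_measure_singleton[OF L gw_family_subtree[OF \<xi>]] by (simp add: Y_def)
  also have "pmf p ?n * (\<Prod>i<?n. pmf L (xs ! i)) = pmf (bind_pmf p (\<lambda>k. replicate_pmf k L)) xs"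
    unfolding pmf_bind pmf_replicate_pmf
    by (subst integral_measure_pmf[of "{?n}"]) (auto split: if_splits)
  finally show "prob {\<omega> \<in> space M. map (\<lambda>i. W (\<lambda>w. \<xi> (i # w) \<omega>)) [0..<\<xi> [] \<omega>] = xs}
      = pmf (bind_pmf p (\<lambda>k. replicate_pmf k L)) xs" .
qed

section \<open>Galton-Watson paths\<close>

lemma sum_iid_pmf_0: "sum_iid_pmf 0 p = return_pmf 0"
  by (simp add: sum_iid_pmf_def)

lemma sum_iid_pmf_Suc: "sum_iid_pmf (Suc k) p = bind_pmf p (\<lambda>x. map_pmf ((+) x) (sum_iid_pmf k p))"
  by (simp add: sum_iid_pmf_def map_pmf_def bind_assoc_pmf bind_return_pmf)

lemma sum_iid_pmf_1: "sum_iid_pmf (Suc 0) p = p"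
  by (simp add: sum_iid_pmf_Suc sum_iid_pmf_0 bind_return_pmf')

lemma sum_iid_pmf_add:
  "sum_iid_pmf (i + j) p = bind_pmf (sum_iid_pmf i p) (\<lambda>x. map_pmf ((+) x) (sum_iid_pmf j p))"
proof (induction i)
  case 0
  have "((+) 0 :: nat \<Rightarrow> nat) = (\<lambda>x. x)" by auto
  then show ?case by (simp add: sum_iid_pmf_0 bind_return_pmf)
next
  case (Suc i)
  then show ?case
    by (simp add: sum_iid_pmf_Suc map_pmf_def bind_assoc_pmf bind_return_pmf add.assoc)
qed

text \<open>Law of the first \<open>Suc n\<close> generation sizes, in recursive form. The initial
  state \<open>k\<close> stays free because the children of the root supply a random initial state
  for the remaining path.\<close>

fun gw_path :: "nat pmf \<Rightarrow> nat \<Rightarrow> nat \<Rightarrow> nat list pmf" where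
  "gw_path p 0 k = return_pmf [k]"
| "gw_path p (Suc n) k = bind_pmf (sum_iid_pmf k p) (\<lambda>j. map_pmf ((#) k) (gw_path p n j))"

lemma gw_path_no_ancestor: "gw_path p n 0 = return_pmf (replicate (Suc n) 0)"
  by (induction n) (simp_all add: sum_iid_pmf_0 bind_return_pmf)

text \<open>Two groups of ancestors have independent descendants, so the path started from
  \<open>i + j\<close> is the entrywise sum of two independent paths.\<close>

lemma gw_path_add:
  "gw_path p n (i + j) = bind_pmf (gw_path p n i) (\<lambda>u. map_pmf (map2 (+) u) (gw_path p n j))"
proof (induction n arbitrary: i j)
  case 0
  show ?case by (simp add: bind_return_pmf)
next
  case (Suc n)
  have "gw_path p (Suc n) (i + j) =
      bind_pmf (sum_iid_pmf i p) (\<lambda>x. bind_pmf (sum_iid_pmf j p) (\<lambda>y.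
        bind_pmf (gw_path p n x) (\<lambda>u. bind_pmf (gw_path p n y) (\<lambda>v. return_pmf ((i + j) # map2 (+) u v)))))"
    by (simp add: sum_iid_pmf_add Suc map_pmf_def bind_assoc_pmf bind_return_pmf)
  \<comment> \<open>Independent draws commute, which brings the two steps of each group
    together.\<close>
  also have "\<dots> = bind_pmf (sum_iid_pmf i p) (\<lambda>x. bind_pmf (gw_path p n x) (\<lambda>u.
        bind_pmf (sum_iid_pmf j p) (\<lambda>y. bind_pmf (gw_path p n y) (\<lambda>v. return_pmf ((i + j) # map2 (+) u v)))))"
    by (intro bind_pmf_cong refl) (rule bind_commute_pmf)
  also have "\<dots> = bind_pmf (gw_path p (Suc n) i) (\<lambda>u. map_pmf (map2 (+) u) (gw_path p (Suc n) j))"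
    by (simp add: map_pmf_def bind_assoc_pmf bind_return_pmf)
  finally show ?case .
qed

text \<open>Link to the product formula in \<open>galton_watson\<close>: after one step only the
  state \<open>y (Suc 0)\<close> contributes to the mixture.\<close>

lemma pmf_gw_path:
  "pmf (gw_path p n k) (map y [0..<Suc n]) =
     (if y 0 = k then 1 else 0) * (\<Prod>i<n. pmf (sum_iid_pmf (y i) p) (y (Suc i)))"
proof (induction n arbitrary: k y)
  case 0
  show ?case by (simp add: indicator_def)
next
  case (Suc n)
  have split: "map y [0..<Suc (Suc n)] = y 0 # map (\<lambda>i. y (Suc i)) [0..<Suc n]"
    by (simp add: upt_conv_Cons map_Suc_upt[symmetric] del: upt_Suc)
  have "pmf (map_pmf ((#) k) (gw_path p n j)) (map y [0..<Suc (Suc n)])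
     = (if y 0 = k then pmf (gw_path p n j) (map (\<lambda>i. y (Suc i)) [0..<Suc n]) else 0)" for j
  proof (cases "y 0 = k")
    case True
    then show ?thesis unfolding split by (simp add: pmf_map_inj' inj_on_def del: upt_Suc)
  next
    case False
    then show ?thesis unfolding split
      by (auto intro!: pmf_eq_0_set_pmf[THEN iffD2] simp del: upt_Suc simp: set_pmf_iff[symmetric])
  qed
  also have "\<And>j. \<dots> j = (if j = y (Suc 0) then (if y 0 = k then 1 else 0) * (\<Prod>i<n. pmf (sum_iid_pmf (y (Suc i)) p) (y (Suc (Suc i)))) else 0)"
    by (simp add: Suc del: upt_Suc)
  finally have "pmf (gw_path p (Suc n) k) (map y [0..<Suc (Suc n)]) =
     pmf (sum_iid_pmf k p) (y (Suc 0)) * ((if y 0 = k then 1 else 0) * (\<Prod>i<n. pmf (sum_iid_pmf (y (Suc i)) p) (y (Suc (Suc i)))))"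
    unfolding gw_path.simps pmf_bind
    by (subst integral_measure_pmf[of "{y (Suc 0)}"]) (auto split: if_splits)
  then show ?case by (auto simp: prod.lessThan_Suc_shift simp del: prod.lessThan_Suc upt_Suc)
qed

lemma galton_watsonI:
  assumes "prob_space N" and "\<And>n. Y n \<in> N \<rightarrow>\<^sub>M count_space UNIV"
    and path: "\<And>n y. measure N {\<omega> \<in> space N. \<forall>i\<le>n. Y i \<omega> = y i} = pmf (gw_path p n 1) (map y [0..<Suc n])"
  shows "galton_watson N Y p"
  unfolding galton_watson_def path pmf_gw_path using assms by auto

text \<open>The zero path of length \<open>Suc n\<close> is the start of the fold because
  \<open>map2\<close> cuts to the shorter list and a childless root must still yield a full
  path.\<close>

definition sum_lists :: "nat \<Rightarrow> nat list list \<Rightarrow> nat list" where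
  "sum_lists n ws = foldr (map2 (+)) ws (replicate (Suc n) 0)"

lemma sum_lists_map:
  "sum_lists n (map (\<lambda>i. map (g i) [0..<Suc n]) js) = map (\<lambda>j. \<Sum>i\<leftarrow>js. g i j) [0..<Suc n]"
proof (induction js)
  case Nil
  show ?case by (simp add: sum_lists_def map_replicate_const del: upt_Suc replicate_Suc)
next
  case (Cons a js)
  then show ?case by (simp add: sum_lists_def map2_map_map del: upt_Suc)
qed

lemma typed_count_path:
  "map (\<lambda>i. typed_count \<phi> i c) [0..<Suc (Suc n)] =
     of_bool (\<phi> c) # sum_lists n (map (\<lambda>j. map (\<lambda>i. typed_count \<phi> i (\<lambda>w. c (j # w))) [0..<Suc n]) [0..<c []])"
proof -
  have "sum_lists n (map (\<lambda>j. map (\<lambda>i. typed_count \<phi> i (\<lambda>w. c (j # w))) [0..<Suc n]) [0..<c []])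
      = map (\<lambda>i. typed_count \<phi> (Suc i) c) [0..<Suc n]"
    unfolding sum_lists_map typed_count_Suc
    by (simp add: interv_sum_list_conv_sum_set_nat atLeast0LessThan)
  moreover have "map (\<lambda>i. typed_count \<phi> i c) [0..<Suc (Suc n)] =
      typed_count \<phi> 0 c # map (\<lambda>i. typed_count \<phi> (Suc i) c) [0..<Suc n]"
    by (simp only: upt_conv_Cons[OF zero_less_Suc] map_Suc_upt[symmetric] list.map list.map_comp comp_def)
  ultimately show ?thesis by (simp only: typed_count_0)
qed

text \<open>Additivity of paths moves the summation to the initial states: independent paths with
  random starts add up to one path started from the sum of the starts.\<close>

lemma sum_lists_replicate_pmf:
  "map_pmf (sum_lists n) (replicate_pmf k (bind_pmf B (gw_path p n))) = bind_pmf (sum_iid_pmf k B) (gw_path p n)"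
proof (induction k)
  case 0
  show ?case by (simp add: sum_iid_pmf_0 bind_return_pmf gw_path_no_ancestor sum_lists_def)
next
  case (Suc k)
  have "map_pmf (sum_lists n) (replicate_pmf (Suc k) (bind_pmf B (gw_path p n))) =
     bind_pmf B (\<lambda>b. bind_pmf (gw_path p n b) (\<lambda>w.
       map_pmf (map2 (+) w) (map_pmf (sum_lists n) (replicate_pmf k (bind_pmf B (gw_path p n))))))"
    by (simp add: map_pmf_def bind_assoc_pmf bind_return_pmf sum_lists_def)
  also have "\<dots> = bind_pmf B (\<lambda>b. bind_pmf (gw_path p n b) (\<lambda>w.
       bind_pmf (sum_iid_pmf k B) (\<lambda>j. map_pmf (map2 (+) w) (gw_path p n j))))"
    by (simp add: Suc map_bind_pmf)
  also have "\<dots> = bind_pmf B (\<lambda>b. bind_pmf (sum_iid_pmf k B) (\<lambda>j. gw_path p n (b + j)))"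
    unfolding gw_path_add by (intro bind_pmf_cong refl) (rule bind_commute_pmf)
  also have "\<dots> = bind_pmf (sum_iid_pmf (Suc k) B) (gw_path p n)"
    by (simp add: sum_iid_pmf_Suc map_pmf_def bind_assoc_pmf bind_return_pmf)
  finally show ?case .
qed

lemma hd_gw_path: "w \<in> set_pmf (gw_path p n k) \<Longrightarrow> hd w = k"
  by (cases n) auto

text \<open>\<open>thin\<close> says that either the root has no infinite line of descent, or the number of its
  children with such a line has law \<open>p2\<close>.\<close>
lemma gw_law_infinite_path:
  assumes B: "gw_law M p (\<lambda>c. of_bool (infinite (family_tree c))) B" "set_pmf B \<subseteq> {0, 1}"
    and p2: "0 \<notin> set_pmf p2"
    and thin: "bind_pmf p (\<lambda>k. sum_iid_pmf k B) = bind_pmf B (\<lambda>b. sum_iid_pmf b p2)"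
  shows "gw_law M p (\<lambda>c. map (\<lambda>i. typed_count (\<lambda>c. infinite (family_tree c)) i c) [0..<Suc n])
           (bind_pmf B (gw_path p2 n))"
proof (induction n)
  case 0
  have "bind_pmf B (gw_path p2 0) = map_pmf (\<lambda>b. [b]) B"
    unfolding map_pmf_def by (rule bind_pmf_cong) simp_all
  with gw_law_map[OF B(1), of "\<lambda>b. [b]"] show ?case
    by (simp add: typed_count_0 del: gw_path.simps)
next
  case (Suc n)
  \<comment> \<open>The root's own flag is recovered from the children: it survives iff the first
    entry of their summed path, the number of surviving children, is positive.\<close>
  let ?h = "\<lambda>w. of_bool (hd w > 0) # w" and ?\<phi> = "\<lambda>c. infinite (family_tree c)"
  have "(of_bool (?\<phi> c) # sum_lists n ws) = ?h (sum_lists n ws)"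
    if "ws = map (\<lambda>j. map (\<lambda>i. typed_count ?\<phi> i (\<lambda>w. c (j # w))) [0..<Suc n]) [0..<c []]" for c ws
  proof -
    have "hd (sum_lists n ws) = (\<Sum>i<c []. typed_count ?\<phi> 0 (\<lambda>w. c (i # w)))"
      unfolding that sum_lists_map
      by (simp add: upt_conv_Cons interv_sum_list_conv_sum_set_nat atLeast0LessThan del: upt_Suc)
    then have "hd (sum_lists n ws) > 0 \<longleftrightarrow> ?\<phi> c"
      by (subst infinite_family_tree_iff) (auto simp: typed_count_0 card_gt_0_iff)
    then show ?thesis by simp
  qed
  then have eq: "map (\<lambda>i. typed_count ?\<phi> i c) [0..<Suc (Suc n)] =
     ?h (sum_lists n (map (\<lambda>j. map (\<lambda>i. typed_count ?\<phi> i (\<lambda>w. c (j # w))) [0..<Suc n]) [0..<c []]))" for c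
    unfolding typed_count_path by blast
  have "map_pmf (\<lambda>ws. ?h (sum_lists n ws)) (bind_pmf p (\<lambda>k. replicate_pmf k (bind_pmf B (gw_path p2 n))))
      = map_pmf ?h (bind_pmf p (\<lambda>k. map_pmf (sum_lists n) (replicate_pmf k (bind_pmf B (gw_path p2 n)))))"
    by (simp add: map_bind_pmf pmf.map_comp comp_def)
  also have "\<dots> = map_pmf ?h (bind_pmf (bind_pmf p (\<lambda>k. sum_iid_pmf k B)) (gw_path p2 n))"
    by (simp add: sum_lists_replicate_pmf bind_assoc_pmf)
  \<comment> \<open>By \<open>thin\<close>, the number of surviving children is drawn by first
    drawing a flag \<open>b\<close> and then a sum of \<open>b\<close> copies of \<open>p2\<close>,
    which is one step of a \<open>gw_path\<close> from \<open>b\<close>.\<close>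
  also have "\<dots> = bind_pmf B (\<lambda>b. bind_pmf (sum_iid_pmf b p2) (\<lambda>j. map_pmf ?h (gw_path p2 n j)))"
    by (simp add: thin bind_assoc_pmf map_bind_pmf)
  also have "\<dots> = bind_pmf B (gw_path p2 (Suc n))"
    unfolding gw_path.simps
  proof (intro bind_pmf_cong refl pmf.map_cong)
    fix b j w assume b: "b \<in> set_pmf B" and j: "j \<in> set_pmf (sum_iid_pmf b p2)"
      and w: "w \<in> set_pmf (gw_path p2 n j)"
    \<comment> \<open>Since \<open>p2\<close> gives no mass to 0, the flag recomputed from the
      children equals the drawn \<open>b\<close>.\<close>
    have "b = 0 \<or> b = Suc 0" using B(2) b by auto
    then have "of_bool (j > 0) = b"
      using j p2 by (auto simp: sum_iid_pmf_0 sum_iid_pmf_1 intro: gr0I)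
    with hd_gw_path[OF w] show "?h w = b # w" by simp
  qed
  finally show ?case
    using gw_law_map[OF gw_law_branch[OF Suc], of "\<lambda>ws. ?h (sum_lists n ws)"]
    unfolding eq by (simp del: gw_path.simps upt_Suc)
qed

text \<open>Restricted to finite trees, the path law has total mass \<open>q\<close> and is not a
  pmf; test functions \<open>h\<close> describe it instead, with values in \<open>ennreal\<close> to
  avoid integrability conditions. Finiteness of \<open>k\<close> child subtrees costs a factor
  \<open>q ^ k\<close>, which the hypothesis on \<open>p1\<close> absorbs.\<close>

lemma gw_law_finite_path:
  fixes p p1 :: "nat pmf" and q :: real
  assumes B: "gw_law M p (\<lambda>c. finite (family_tree c)) B" "pmf B True = q"
    and p1: "\<And>k. q * pmf p1 k = pmf p k * q ^ k"
  shows "\<exists>L. gw_law M p (\<lambda>c. (finite (family_tree c), map (\<lambda>i. total_count i c) [0..<Suc n])) L \<and>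
     (\<forall>h :: nat list \<Rightarrow> ennreal. (\<integral>\<^sup>+x. (if fst x then h (snd x) else 0) \<partial>L) = ennreal q * (\<integral>\<^sup>+x. h x \<partial>gw_path p1 n 1))"
proof (induction n)
  case 0
  have q: "q = measure B {True}" using B(2) by (simp add: measure_pmf_single)
  have "(\<integral>\<^sup>+x. (if x then h [Suc 0] else 0) \<partial>B) = ennreal q * h [Suc 0]" for h :: "nat list \<Rightarrow> ennreal"
  proof -
    have "(\<integral>\<^sup>+x. (if x then h [Suc 0] else 0) \<partial>B) = (\<integral>\<^sup>+x. h [Suc 0] * indicator {True} x \<partial>B)"
      by (intro nn_integral_cong) (auto simp: indicator_def)
    also have "\<dots> = ennreal q * h [Suc 0]"
      by (subst nn_integral_cmult_indicator) (auto simp: q measure_pmf.emeasure_eq_measure mult.commute)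
    finally show ?thesis .
  qed
  with gw_law_map[OF B(1), of "\<lambda>b. (b, [Suc 0])"] show ?case
    by (intro exI[of _ "map_pmf (\<lambda>b. (b, [Suc 0])) B"]) (simp add: typed_count_0 cong: if_cong)
next
  case (Suc n)
  have q0: "q \<ge> 0" using B(2) by auto
  let ?U = "\<lambda>n c. map (\<lambda>i. total_count i c) [0..<Suc n]"
  obtain L where L: "gw_law M p (\<lambda>c. (finite (family_tree c), ?U n c)) L"
    and Lh: "\<And>h :: nat list \<Rightarrow> ennreal. (\<integral>\<^sup>+x. (if fst x then h (snd x) else 0) \<partial>L) = ennreal q * (\<integral>\<^sup>+x. h x \<partial>gw_path p1 n 1)"
    using Suc by blast
  \<comment> \<open>The tree is finite iff all child subtrees are; the paths add.\<close>
  define H where "H ws = (list_all fst ws, sum_lists n (map snd ws))" for ws :: "(bool \<times> nat list) list"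
  have S: "(\<integral>\<^sup>+ws. (if fst (H ws) then h (snd (H ws)) else 0) \<partial>replicate_pmf k L)
      = ennreal (q ^ k) * (\<integral>\<^sup>+x. h x \<partial>gw_path p1 n k)" for k and h :: "nat list \<Rightarrow> ennreal"
  proof (induction k arbitrary: h)
    case 0
    show ?case by (simp add: H_def sum_lists_def gw_path_no_ancestor)
  next
    case (Suc k)
    have "(\<integral>\<^sup>+ws. (if fst (H ws) then h (snd (H ws)) else 0) \<partial>replicate_pmf (Suc k) L)
      = (\<integral>\<^sup>+x. (if fst x then \<integral>\<^sup>+ws. (if fst (H ws) then h (map2 (+) (snd x) (snd (H ws))) else 0) \<partial>replicate_pmf k L else 0) \<partial>L)"
      by (auto simp: H_def sum_lists_def intro!: nn_integral_cong)
    also have "\<dots> = (\<integral>\<^sup>+x. (if fst x then ennreal (q ^ k) * (\<integral>\<^sup>+v. h (map2 (+) (snd x) v) \<partial>gw_path p1 n k) else 0) \<partial>L)"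
      by (intro nn_integral_cong if_cong refl) (rule Suc.IH[of "\<lambda>v. h (map2 (+) u v)" for u])
    also have "\<dots> = ennreal q * (\<integral>\<^sup>+u. ennreal (q ^ k) * (\<integral>\<^sup>+v. h (map2 (+) u v) \<partial>gw_path p1 n k) \<partial>gw_path p1 n 1)"
      by (rule Lh[of "\<lambda>u. ennreal (q ^ k) * (\<integral>\<^sup>+v. h (map2 (+) u v) \<partial>gw_path p1 n k)"])
    also have "\<dots> = ennreal (q ^ Suc k) * (\<integral>\<^sup>+x. h x \<partial>gw_path p1 n (1 + k))"
      using q0 by (simp add: gw_path_add[of _ _ 1 k, simplified] nn_integral_cmult ennreal_mult mult.assoc)
    finally show ?case by simp
  qed
  let ?G = "\<lambda>ws. (fst (H ws), 1 # snd (H ws))"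
  let ?L = "map_pmf ?G (bind_pmf p (\<lambda>k. replicate_pmf k L))"
  have "(\<integral>\<^sup>+x. (if fst x then h (snd x) else 0) \<partial>?L) = ennreal q * (\<integral>\<^sup>+x. h x \<partial>gw_path p1 (Suc n) 1)"
    for h :: "nat list \<Rightarrow> ennreal"
  proof -
    have "(\<integral>\<^sup>+x. (if fst x then h (snd x) else 0) \<partial>?L)
       = (\<integral>\<^sup>+k. ennreal (q ^ k) * (\<integral>\<^sup>+x. h (1 # x) \<partial>gw_path p1 n k) \<partial>p)"
      using S[where h = "\<lambda>x. h (Suc 0 # x)"] by (simp cong: if_cong)
    also have "\<dots> = (\<integral>\<^sup>+k. ennreal (pmf p k) * (ennreal (q ^ k) * (\<integral>\<^sup>+x. h (1 # x) \<partial>gw_path p1 n k)) \<partial>count_space UNIV)"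
      by (rule nn_integral_measure_pmf)
    \<comment> \<open>The weight \<open>q ^ k\<close> turns \<open>p\<close> into \<open>p1\<close>,
      leaving a single factor \<open>q\<close> for the root.\<close>
    also have "\<dots> = (\<integral>\<^sup>+k. ennreal q * (ennreal (pmf p1 k) * (\<integral>\<^sup>+x. h (1 # x) \<partial>gw_path p1 n k)) \<partial>count_space UNIV)"
      using p1 q0 by (simp add: ennreal_mult[symmetric] mult.assoc[symmetric])
    also have "\<dots> = ennreal q * (\<integral>\<^sup>+k. (\<integral>\<^sup>+x. h (1 # x) \<partial>gw_path p1 n k) \<partial>p1)"
      by (subst nn_integral_cmult) (simp_all add: nn_integral_measure_pmf)
    also have "\<dots> = ennreal q * (\<integral>\<^sup>+x. h x \<partial>gw_path p1 (Suc n) 1)"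
      by (simp add: sum_iid_pmf_1)
    finally show ?thesis .
  qed
  moreover have "(\<lambda>c. (finite (family_tree c), ?U (Suc n) c)) =
      (\<lambda>c. ?G (map (\<lambda>i. (finite (family_tree (\<lambda>w. c (i # w))), ?U n (\<lambda>w. c (i # w)))) [0..<c []]))"
  proof (rule ext)
    fix c
    show "(finite (family_tree c), ?U (Suc n) c) =
      ?G (map (\<lambda>i. (finite (family_tree (\<lambda>w. c (i # w))), ?U n (\<lambda>w. c (i # w)))) [0..<c []])"
      using infinite_family_tree_iff[of c] unfolding typed_count_path[of "\<lambda>_. True"]
      by (auto simp: H_def list_all_iff comp_def simp del: upt_Suc)
  qed
  then have "gw_law M p (\<lambda>c. (finite (family_tree c), ?U (Suc n) c)) ?L"
    using gw_law_map[OF gw_law_branch[OF L], of ?G] by (simp only:)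
  ultimately show ?case by (intro exI[of _ ?L] conjI allI)
qed

section \<open>Generating functions, extinction and explosion\<close>

text \<open>An expectation rather than a series, so that mixtures are handled by integration over
  \<open>bind_pmf\<close>; \<open>pgf_sums\<close> returns to the series used in
  \<open>is_PF\<close>.\<close>

definition pgf :: "nat pmf \<Rightarrow> real \<Rightarrow> real" where
  "pgf p s = measure_pmf.expectation p (\<lambda>k. s ^ k)"

lemma integrable_pmf_power:
  fixes s :: real
  assumes "0 \<le> s" "s \<le> 1"
  shows "integrable (measure_pmf p) (\<lambda>k. s ^ k)"
  by (rule measure_pmf.integrable_const_bound[where B = 1]) (use assms in \<open>auto simp: power_le_one\<close>)

lemma pgf_sums:
  assumes "0 \<le> s" "s \<le> 1"
  shows "(\<lambda>k. pmf p k * s ^ k) sums pgf p s"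
proof -
  have "integrable (count_space UNIV) (\<lambda>k. pmf p k * s ^ k)"
    using integrable_pmf_power[OF assms, of p] by (simp add: measure_pmf_eq_density integrable_density)
  from sums_integral_count_space_nat[OF this] show ?thesis
    by (simp add: pgf_def measure_pmf_eq_density integral_density)
qed

lemma pgf_0: "pgf p 0 = pmf p 0"
proof -
  have "(\<lambda>k::nat. 0 ^ k :: real) = indicator {0}" by (auto simp: fun_eq_iff indicator_def)
  then show ?thesis by (simp add: pgf_def measure_pmf_single)
qed

lemma pgf_return: "pgf (return_pmf k) s = s ^ k"
  by (simp add: pgf_def)

lemma pgf_map_add: "pgf (map_pmf ((+) k) p) s = s ^ k * pgf p s"
  by (simp add: pgf_def power_add)

lemma pgf_bind:
  assumes "0 \<le> s" "s \<le> 1"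
  shows "pgf (bind_pmf p K) s = measure_pmf.expectation p (\<lambda>x. pgf (K x) s)"
  unfolding pgf_def measure_pmf_bind
  using measurable_measure_pmf[of K] assms
  by (intro integral_bind[where B = 1 and B' = 1 and K = "count_space UNIV"])
     (simp_all add: power_le_one measure_pmf.finite_measure_axioms)

lemma pgf_sum_iid:
  assumes "0 \<le> s" "s \<le> 1"
  shows "pgf (sum_iid_pmf k p) s = pgf p s ^ k"
proof (induction k)
  case 0
  show ?case by (simp add: sum_iid_pmf_0 pgf_return)
next
  case (Suc k)
  then show ?case
    by (simp add: sum_iid_pmf_Suc pgf_bind[OF assms] pgf_map_add) (simp add: pgf_def)
qed

lemma pgf_compound:
  assumes "0 \<le> s" "s \<le> 1"
  shows "pgf (bind_pmf p (\<lambda>k. sum_iid_pmf k L)) s = pgf p (pgf L s)"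
  by (simp add: pgf_bind[OF assms] pgf_sum_iid[OF assms]) (simp add: pgf_def)

fun gen_law :: "nat pmf \<Rightarrow> nat \<Rightarrow> nat pmf" where
  "gen_law p 0 = return_pmf 1"
| "gen_law p (Suc n) = bind_pmf p (\<lambda>k. sum_iid_pmf k (gen_law p n))"

lemma gw_law_total_count: "gw_law M p (total_count n) (gen_law p n)"
proof (induction n)
  case 0
  show ?case
    by (rule gw_lawI) (auto simp: typed_count_0 gw_family_def prob_space.prob_space measurable_total_count
        indicator_def)
next
  case (Suc n)
  have "total_count (Suc n) = (\<lambda>c. sum_list (map (\<lambda>i. total_count n (\<lambda>w. c (i # w))) [0..<c []]))"
    by (simp add: fun_eq_iff typed_count_Suc interv_sum_list_conv_sum_set_nat atLeast0LessThan)
  moreover have "gen_law p (Suc n) = map_pmf sum_list (bind_pmf p (\<lambda>k. replicate_pmf k (gen_law p n)))"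
    by (simp add: map_bind_pmf sum_iid_pmf_def)
  ultimately show ?case
    using gw_law_map[OF gw_law_branch[OF Suc], of sum_list] by (simp only:)
qed

lemma pgf_gen_law:
  assumes "0 \<le> s" "s \<le> 1"
  shows "pgf (gen_law p n) s = (pgf p ^^ n) s"
  by (induction n) (use assms in \<open>simp_all add: pgf_return pgf_compound\<close>)

section \<open>Extinction probability and the extinction-explosion dichotomy\<close>

lemma measurable_gw_Z:
  assumes "gw_family M \<xi> p"
  shows "gw_Z \<xi> n \<in> M \<rightarrow>\<^sub>M count_space UNIV"
  unfolding gw_Z_eq[abs_def]
  by (rule measurable_compose[OF gw_family_measurable[OF assms] measurable_total_count])

lemma sets_extinction:
  assumes "gw_family M \<xi> p"
  shows "extinction M \<xi> \<in> sets M"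
proof -
  note [measurable] = measurable_gw_Z[OF assms]
  show ?thesis unfolding extinction_def by measurable
qed

lemma sets_explosion:
  assumes "gw_family M \<xi> p"
  shows "explosion M \<xi> \<in> sets M"
proof -
  note [measurable] = measurable_gw_Z[OF assms]
  show ?thesis unfolding explosion_def filterlim_at_top eventually_sequentially by measurable
qed

lemma extinction_iff: "\<omega> \<in> extinction M \<xi> \<longleftrightarrow> \<omega> \<in> space M \<and> finite (family_tree (\<lambda>v. \<xi> v \<omega>))"
  by (simp add: extinction_def gw_Z_eq finite_family_tree_iff_count)

lemma prob_gw_Z:
  assumes "gw_family M \<xi> p"
  shows "measure M {\<omega> \<in> space M. gw_Z \<xi> n \<omega> \<in> A} = measure (gen_law p n) A"
  unfolding gw_Z_eq by (rule gw_law_measure[OF gw_law_total_count assms])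

lemma gw_Z_eq_0_mono: "gw_Z \<xi> n \<omega> = 0 \<Longrightarrow> n \<le> m \<Longrightarrow> gw_Z \<xi> m \<omega> = 0"
  unfolding gw_Z_eq total_count_eq_0_iff by (rule generation_empty_mono)

text \<open>The events that generation \<open>n\<close> is empty increase to extinction and have the
  iterates at 0 as probabilities. Their limit is a hypothesis because the iterates are explicit for
  power-fractional laws.\<close>

lemma extinction_prob:
  assumes \<xi>: "gw_family M \<xi> p" and lim: "(\<lambda>n. (pgf p ^^ n) 0) \<longlonglongrightarrow> q"
  shows "measure M (extinction M \<xi>) = q"
proof -
  interpret prob_space M using \<xi> by (simp add: gw_family_def)
  note [measurable] = measurable_gw_Z[OF \<xi>]
  let ?A = "\<lambda>n. {\<omega> \<in> space M. gw_Z \<xi> n \<omega> = 0}"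
  have "(\<lambda>n. prob (?A n)) \<longlonglongrightarrow> prob (\<Union>n. ?A n)"
  proof (rule finite_Lim_measure_incseq)
    show "range ?A \<subseteq> events" by auto
    show "incseq ?A" by (auto simp: incseq_def gw_Z_eq_0_mono)
  qed
  moreover have "(\<Union>n. ?A n) = extinction M \<xi>" by (auto simp: extinction_def)
  moreover have "prob (?A n) = (pgf p ^^ n) 0" for n
    using prob_gw_Z[OF \<xi>, of n "{0}"] pgf_gen_law[of 0 p n] by (simp add: pgf_0 measure_pmf_single)
  ultimately show ?thesis using lim LIMSEQ_unique by auto
qed

text \<open>A small positive population dies out in the next generation with probability bounded from
  below, so \<open>P(0 < Z_n \<le> K)\<close> is dominated by a telescoping series.\<close>
lemma AE_extinction_or_explosion:
  assumes \<xi>: "gw_family M \<xi> p" and lim: "(\<lambda>n. (pgf p ^^ n) 0) \<longlonglongrightarrow> q" and p0: "0 < pmf p 0"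
  shows "AE \<omega> in M. \<omega> \<in> extinction M \<xi> \<or> \<omega> \<in> explosion M \<xi>"
proof -
  interpret prob_space M using \<xi> by (simp add: gw_family_def)
  note [measurable] = measurable_gw_Z[OF \<xi>]
  let ?A = "\<lambda>K n. {\<omega> \<in> space M. gw_Z \<xi> n \<omega> \<in> {0<..K}}"
  let ?x = "\<lambda>n. (pgf p ^^ n) 0"
  \<comment> \<open>At \<open>s = pmf p 0\<close> the generating function of generation
    \<open>n\<close> is the probability that generation \<open>Suc n\<close> is empty. Sizes in
    \<open>{0<..K}\<close> contribute at least \<open>s ^ K\<close> each, size 0 contributes
    1.\<close>
  have bound: "prob (?A K n) \<le> (?x (Suc n) - ?x n) / pmf p 0 ^ K" for K n
  proof -
    let ?L = "gen_law p n" and ?s = "pmf p 0"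
    have s: "0 \<le> ?s" "?s \<le> 1" by (auto simp: pmf_le_1)
    have ind: "integrable ?L (indicator A :: nat \<Rightarrow> real)" for A
      by (rule measure_pmf.integrable_const_bound[where B = 1]) (auto simp: indicator_def)
    have "?s ^ K * measure ?L {0<..K} + pmf ?L 0
        = measure_pmf.expectation ?L (\<lambda>k. ?s ^ K * indicator {0<..K} k + indicator {0} k)"
      by (subst Bochner_Integration.integral_add) (simp_all add: measure_pmf_single ind)
    also have "\<dots> \<le> pgf ?L ?s"
      unfolding pgf_def
    proof (rule integral_mono)
      fix k
      show "?s ^ K * indicator {0<..K} k + indicator {0} k \<le> ?s ^ k"
        using s power_decreasing[OF _ s, of k K] by (auto simp: indicator_def)
    qed (intro Bochner_Integration.integrable_add Bochner_Integration.integrable_mult_right ind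
        integrable_pmf_power s)+
    also have "pgf ?L ?s = ?x (Suc n)"
      using pgf_gen_law[OF s, of p n] by (simp add: funpow_swap1 pgf_0)
    finally have "?s ^ K * measure ?L {0<..K} \<le> ?x (Suc n) - ?x n"
      using pgf_gen_law[of 0 p n] by (simp add: pgf_0)
    then show ?thesis using p0 prob_gw_Z[OF \<xi>, of n "{0<..K}"] by (simp add: field_simps)
  qed
  \<comment> \<open>Borel-Cantelli: almost surely the sizes lie in \<open>{0<..K}\<close> only
    finitely often.\<close>
  have "AE \<omega> in M. \<forall>\<^sub>F n in sequentially. \<omega> \<in> space M - ?A K n" for K
  proof (rule borel_cantelli_AE1)
    show "summable (\<lambda>n. prob (?A K n))"
    proof (rule summable_comparison_test')
      show "summable (\<lambda>n. (?x (Suc n) - ?x n) / pmf p 0 ^ K)"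
        by (intro summable_divide telescope_summable[OF lim])
    qed (use bound in simp)
  qed (auto simp: emeasure_eq_measure)
  then have "AE \<omega> in M. \<forall>K. \<forall>\<^sub>F n in sequentially. \<omega> \<in> space M - ?A K n"
    by (simp add: AE_all_countable)
  then show ?thesis
  proof eventually_elim
    case (elim \<omega>)
    have "\<forall>\<^sub>F n :: nat in sequentially. \<omega> \<in> space M"
      using elim[rule_format, of 0] by (rule eventually_mono) simp
    then have \<omega>: "\<omega> \<in> space M" by simp
    show ?case
    proof (rule disjCI)
      assume "\<omega> \<notin> explosion M \<xi>"
      then obtain K where K: "\<not> (\<forall>\<^sub>F n in sequentially. K \<le> gw_Z \<xi> n \<omega>)"
        using \<omega> by (auto simp: explosion_def filterlim_at_top)
      have "\<exists>n. gw_Z \<xi> n \<omega> = 0"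
      proof (rule ccontr)
        assume "\<not> ?thesis"
        then have "\<forall>\<^sub>F n in sequentially. K \<le> gw_Z \<xi> n \<omega>"
          using elim[rule_format, of K] by (auto elim!: eventually_mono)
        with K show False ..
      qed
      with \<omega> show "\<omega> \<in> extinction M \<xi>" by (simp add: extinction_def)
    qed
  qed
qed

lemma extinction_explosion_disjoint: "extinction M \<xi> \<inter> explosion M \<xi> = {}"
proof -
  have False if "gw_Z \<xi> n \<omega> = 0" "filterlim (\<lambda>n. gw_Z \<xi> n \<omega>) at_top sequentially" for n \<omega>
  proof -
    have "\<forall>\<^sub>F m in sequentially. 1 \<le> gw_Z \<xi> m \<omega>"
      using that(2) unfolding filterlim_at_top by blast
    then obtain N where "\<And>m. m \<ge> N \<Longrightarrow> 1 \<le> gw_Z \<xi> m \<omega>"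
      unfolding eventually_sequentially by blast
    from this[of "max n N"] gw_Z_eq_0_mono[OF that(1), of "max n N"] show False by simp
  qed
  then show ?thesis by (auto simp: extinction_def explosion_def)
qed

section \<open>The two conditioned processes\<close>

lemma embed_pmf_nat:
  fixes g :: "nat \<Rightarrow> real"
  assumes "\<And>k. 0 \<le> g k" "g sums 1"
  shows "pmf (embed_pmf g) k = g k"
proof (rule pmf_embed_pmf)
  show "(\<integral>\<^sup>+k. ennreal (g k) \<partial>count_space UNIV) = 1"
    using suminf_ennreal_eq[OF assms] by (simp add: nn_integral_count_space_nat)
qed (rule assms)

lemma gw_law_finite_family_tree:
  assumes lim: "(\<lambda>n. (pgf p ^^ n) 0) \<longlonglongrightarrow> q" and q: "0 \<le> q" "q \<le> 1"
  shows "gw_law M p (\<lambda>c. finite (family_tree c)) (bernoulli_pmf q)"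
proof (rule gw_lawI)
  show "(\<lambda>c. finite (family_tree c)) \<in> tree_space \<rightarrow>\<^sub>M count_space UNIV"
    by (rule pred_finite_family_tree)
  fix \<xi> x assume \<xi>: "gw_family M \<xi> p"
  interpret prob_space M using \<xi> by (simp add: gw_family_def)
  have E: "{\<omega> \<in> space M. finite (family_tree (\<lambda>v. \<xi> v \<omega>))} = extinction M \<xi>"
    by (auto simp: extinction_iff)
  have "{\<omega> \<in> space M. finite (family_tree (\<lambda>v. \<xi> v \<omega>)) = False} = space M - extinction M \<xi>"
    by (auto simp: extinction_iff)
  then have "prob {\<omega> \<in> space M. finite (family_tree (\<lambda>v. \<xi> v \<omega>)) = False} = 1 - q"
    using prob_compl[OF sets_extinction[OF \<xi>]] extinction_prob[OF \<xi> lim] by (simp only:)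
  then show "prob {\<omega> \<in> space M. finite (family_tree (\<lambda>v. \<xi> v \<omega>)) = x} = pmf (bernoulli_pmf q) x"
    using E extinction_prob[OF \<xi> lim] q by (cases x) simp_all
qed

lemma measurable_gw_Z1:
  assumes "gw_family M \<xi> p"
  shows "gw_Z1 \<xi> n \<in> M \<rightarrow>\<^sub>M count_space UNIV"
  unfolding gw_Z1_eq[abs_def]
  by (rule measurable_compose[OF gw_family_measurable[OF assms] measurable_typed_count[OF pred_finite_family_tree]])

lemma measurable_gw_Z2:
  assumes "gw_family M \<xi> p"
  shows "gw_Z2 \<xi> n \<in> M \<rightarrow>\<^sub>M count_space UNIV"
  unfolding gw_Z2_eq[abs_def]
  by (rule measurable_compose[OF gw_family_measurable[OF assms] measurable_typed_count[OF pred_infinite_family_tree]])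

lemma map_eq_upt_iff: "map x [0..<Suc n] = map y [0..<Suc n] \<longleftrightarrow> (\<forall>i\<le>n. x i = y i)"
  by (auto simp: less_Suc_eq_le simp del: upt_Suc)

text \<open>Clears the denominator of the conditional probability, so path laws can be computed as
  joint probabilities under \<open>M\<close>.\<close>

lemma galton_watson_uniformI:
  assumes \<xi>: "prob_space M" and A: "A \<in> sets M" "0 < measure M A"
    and Y: "\<And>n. Y n \<in> M \<rightarrow>\<^sub>M count_space UNIV"
    and path: "\<And>n y. measure M {\<omega> \<in> A. \<forall>i\<le>n. Y i \<omega> = y i} = measure M A * pmf (gw_path p n 1) (map y [0..<Suc n])"
  shows "galton_watson (uniform_measure M A) Y p"
proof (rule galton_watsonI)
  interpret prob_space M by (rule \<xi>)
  have A0: "emeasure M A \<noteq> 0" "emeasure M A \<noteq> \<infinity>" using A(2) by (auto simp: emeasure_eq_measure)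
  then show "prob_space (uniform_measure M A)" by (rule prob_space_uniform_measure)
  show "Y n \<in> uniform_measure M A \<rightarrow>\<^sub>M count_space UNIV" for n
    using Y[of n] by (simp add: measurable_def)
  fix n and y :: "nat \<Rightarrow> nat"
  let ?B = "{\<omega> \<in> space M. \<forall>i\<le>n. Y i \<omega> = y i}"
  note [measurable] = Y
  have B: "?B \<in> sets M" by measurable
  have "A \<inter> ?B = {\<omega> \<in> A. \<forall>i\<le>n. Y i \<omega> = y i}" using sets.sets_into_space[OF A(1)] by auto
  then show "measure (uniform_measure M A) {\<omega> \<in> space (uniform_measure M A). \<forall>i\<le>n. Y i \<omega> = y i}
      = pmf (gw_path p n 1) (map y [0..<Suc n])"
    using A(2) measure_uniform_measure[OF A0 B] path[of n y] by (simp del: upt_Suc)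
qed

lemma galton_watson_Z1:
  assumes \<xi>: "gw_family M \<xi> p" and lim: "(\<lambda>n. (pgf p ^^ n) 0) \<longlonglongrightarrow> q" and q: "0 < q" "q \<le> 1"
    and p1: "\<And>k. q * pmf p1 k = pmf p k * q ^ k"
  shows "galton_watson (uniform_measure M (extinction M \<xi>)) (gw_Z1 \<xi>) p1"
proof (rule galton_watson_uniformI)
  have E: "measure M (extinction M \<xi>) = q" by (rule extinction_prob[OF \<xi> lim])
  then show "0 < measure M (extinction M \<xi>)" using q by simp
  show "extinction M \<xi> \<in> sets M" "gw_Z1 \<xi> n \<in> M \<rightarrow>\<^sub>M count_space UNIV" for n
    using \<xi> by (rule sets_extinction measurable_gw_Z1)+
  show "prob_space M" using \<xi> by (simp add: gw_family_def)
  fix n and y :: "nat \<Rightarrow> nat"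
  let ?y = "map y [0..<Suc n]" and ?W = "\<lambda>c. (finite (family_tree c), map (\<lambda>i. total_count i c) [0..<Suc n])"
  have "pmf (bernoulli_pmf q) True = q" using q by simp
  then obtain L where L: "gw_law M p ?W L"
    and Lh: "\<And>h :: nat list \<Rightarrow> ennreal. (\<integral>\<^sup>+x. (if fst x then h (snd x) else 0) \<partial>L) = ennreal q * (\<integral>\<^sup>+x. h x \<partial>gw_path p1 n 1)"
    using gw_law_finite_path[OF gw_law_finite_family_tree[OF lim less_imp_le[OF q(1)] q(2)] _ p1] by blast
  \<comment> \<open>On extinction \<open>gw_Z1\<close> is the total population, so the event is an
    atom of the joint law of flag and path.\<close>
  have "{\<omega> \<in> extinction M \<xi>. \<forall>i\<le>n. gw_Z1 \<xi> i \<omega> = y i} = {\<omega> \<in> space M. ?W (\<lambda>v. \<xi> v \<omega>) = (True, ?y)}"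
    unfolding Pair_inject map_eq_upt_iff
    by (auto simp: extinction_iff gw_Z1_eq typed_count_finite_tree)
  then have "measure M {\<omega> \<in> extinction M \<xi>. \<forall>i\<le>n. gw_Z1 \<xi> i \<omega> = y i} = pmf L (True, ?y)"
    using gw_law_measure_singleton[OF L \<xi>, of "(True, ?y)"] by (simp only:)
  moreover have "ennreal (pmf L (True, ?y)) = ennreal (q * pmf (gw_path p1 n 1) ?y)"
  proof -
    have "(\<integral>\<^sup>+x. (if fst x then indicator {?y} (snd x) else 0) \<partial>L) = (\<integral>\<^sup>+x. indicator {(True, ?y)} x \<partial>L)"
      by (intro nn_integral_cong) (auto simp: indicator_def)
    also have "\<dots> = ennreal (pmf L (True, ?y))"
      by (simp add: emeasure_pmf_single del: upt_Suc)
    finally show ?thesis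
      using Lh[of "indicator {?y}"] q by (simp add: emeasure_pmf_single ennreal_mult del: upt_Suc)
  qed
  ultimately show "measure M {\<omega> \<in> extinction M \<xi>. \<forall>i\<le>n. gw_Z1 \<xi> i \<omega> = y i}
      = measure M (extinction M \<xi>) * pmf (gw_path p1 n 1) ?y"
    using q unfolding E by (simp del: upt_Suc)
qed

lemma galton_watson_Z2:
  assumes \<xi>: "gw_family M \<xi> p" and lim: "(\<lambda>n. (pgf p ^^ n) 0) \<longlonglongrightarrow> q" and q: "0 \<le> q" "q < 1"
    and p0: "0 < pmf p 0" and B: "B = map_pmf (\<lambda>b. of_bool (\<not> b)) (bernoulli_pmf q)"
    and p2: "0 \<notin> set_pmf p2"
    and thin: "bind_pmf p (\<lambda>k. sum_iid_pmf k B) = bind_pmf B (\<lambda>b. sum_iid_pmf b p2)"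
  shows "galton_watson (uniform_measure M (explosion M \<xi>)) (gw_Z2 \<xi>) p2"
proof (rule galton_watson_uniformI)
  show "prob_space M" using \<xi> by (simp add: gw_family_def)
  then interpret prob_space M .
  note E [measurable] = sets_extinction[OF \<xi>] and X [measurable] = sets_explosion[OF \<xi>]
  have Y [measurable]: "gw_Z2 \<xi> n \<in> M \<rightarrow>\<^sub>M count_space UNIV" for n
    by (rule measurable_gw_Z2[OF \<xi>])
  then show "gw_Z2 \<xi> n \<in> M \<rightarrow>\<^sub>M count_space UNIV" for n .
  show "explosion M \<xi> \<in> sets M" by (rule X)
  \<comment> \<open>Explosion is traded for survival, which is a property of the tree alone.\<close>
  have AE: "AE \<omega> in M. \<omega> \<in> explosion M \<xi> \<longleftrightarrow> \<omega> \<in> space M - extinction M \<xi>"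
    using AE_extinction_or_explosion[OF \<xi> lim p0] AE_space
    by eventually_elim (use extinction_explosion_disjoint[of M \<xi>] in blast)
  have "prob (explosion M \<xi>) = prob (space M - extinction M \<xi>)"
    by (rule finite_measure_eq_AE[OF AE]) auto
  then have PX: "prob (explosion M \<xi>) = 1 - q"
    using prob_compl[OF E] extinction_prob[OF \<xi> lim] by simp
  then show "0 < prob (explosion M \<xi>)" using q by simp
  have "gw_law M p (\<lambda>c. of_bool (infinite (family_tree c))) B"
    unfolding B by (rule gw_law_map[OF gw_law_finite_family_tree[OF lim]]) (use q in auto)
  then have L: "gw_law M p (\<lambda>c. map (\<lambda>i. typed_count (\<lambda>c. infinite (family_tree c)) i c) [0..<Suc n])
      (bind_pmf B (gw_path p2 n))" for n
    by (rule gw_law_infinite_path) (auto simp: B p2 thin[unfolded B])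
  fix n and y :: "nat \<Rightarrow> nat"
  let ?y = "map y [0..<Suc n]" and ?P = "\<lambda>\<omega>. \<forall>i\<le>n. gw_Z2 \<xi> i \<omega> = y i"
  have "prob {\<omega> \<in> explosion M \<xi>. ?P \<omega>} = prob {\<omega> \<in> space M. \<omega> \<notin> extinction M \<xi> \<and> ?P \<omega>}"
  proof (rule finite_measure_eq_AE)
    show "AE \<omega> in M. \<omega> \<in> {\<omega> \<in> explosion M \<xi>. ?P \<omega>} \<longleftrightarrow> \<omega> \<in> {\<omega> \<in> space M. \<omega> \<notin> extinction M \<xi> \<and> ?P \<omega>}"
      using AE by eventually_elim auto
    have "{\<omega> \<in> explosion M \<xi>. ?P \<omega>} = explosion M \<xi> \<inter> {\<omega> \<in> space M. ?P \<omega>}"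
      using sets.sets_into_space[OF X] by auto
    also have "\<dots> \<in> events" by measurable
    finally show "{\<omega> \<in> explosion M \<xi>. ?P \<omega>} \<in> events" .
  qed measurable
  also have "\<dots> = (1 - q) * pmf (gw_path p2 n 1) ?y"
  proof (cases "y 0 = 1")
    case True
    \<comment> \<open>Entry 0 of the path is the survival flag of the root, so
      \<open>y 0 = 1\<close> already forces survival; in the mixture over \<open>B\<close> the paths
      started from 0 then drop out.\<close>
    have "\<omega> \<notin> extinction M \<xi>" if "\<omega> \<in> space M" "?P \<omega>" for \<omega>
      using that(2)[rule_format, of 0] True that(1)
      by (auto simp: gw_Z2_eq typed_count_0 extinction_iff split: if_splits)
    then have "{\<omega> \<in> space M. \<omega> \<notin> extinction M \<xi> \<and> ?P \<omega>}
       = {\<omega> \<in> space M. map (\<lambda>i. typed_count (\<lambda>c. infinite (family_tree c)) i (\<lambda>v. \<xi> v \<omega>)) [0..<Suc n] = ?y}"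
      unfolding map_eq_upt_iff gw_Z2_eq by auto
    then have "prob {\<omega> \<in> space M. \<omega> \<notin> extinction M \<xi> \<and> ?P \<omega>} = pmf (bind_pmf B (gw_path p2 n)) ?y"
      using gw_law_measure_singleton[OF L \<xi>] by (simp only:)
    also have "\<dots> = q * pmf (gw_path p2 n 0) ?y + (1 - q) * pmf (gw_path p2 n 1) ?y"
      using q by (simp add: B bind_map_pmf pmf_bind del: upt_Suc)
    also have "pmf (gw_path p2 n 0) ?y = 0" using True by (simp add: pmf_gw_path del: upt_Suc)
    finally show ?thesis by simp
  next
    case False
    \<comment> \<open>On survival entry 0 equals 1, so no other initial value occurs.\<close>
    then have "{\<omega> \<in> space M. \<omega> \<notin> extinction M \<xi> \<and> ?P \<omega>} = {}"
      by (auto simp: gw_Z2_eq typed_count_0 extinction_iff dest: spec[of _ 0])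
    moreover have "pmf (gw_path p2 n 1) ?y = 0" using False by (simp add: pmf_gw_path del: upt_Suc)
    ultimately show ?thesis by (simp only: measure_empty mult_zero_right)
  qed
  finally show "prob {\<omega> \<in> explosion M \<xi>. ?P \<omega>} = prob (explosion M \<xi>) * pmf (gw_path p2 n 1) ?y"
    by (simp only: PX)
qed

text \<open>The weights \<open>pmf p k * q ^ k / q\<close> have total mass
  \<open>pgf p q / q\<close>, which is 1 exactly by the fixed-point equation.\<close>

lemma finite_progeny_offspring_law:
  assumes "0 < q" "q \<le> 1" "pgf p q = q"
  obtains p1 where "\<And>k. q * pmf p1 k = pmf p k * q ^ k"
proof
  have "(\<lambda>k. pmf p k * q ^ k / q) sums (q / q)"
    using pgf_sums[of q p] assms by (intro sums_divide) auto
  then show "q * pmf (embed_pmf (\<lambda>k. pmf p k * q ^ k / q)) k = pmf p k * q ^ k" for k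
    using assms by (subst embed_pmf_nat) auto
qed

lemma infinite_line_offspring_law:
  assumes q: "0 \<le> q" "q < 1" "pgf p q = q" and B: "B = map_pmf (\<lambda>b. of_bool (\<not> b)) (bernoulli_pmf q)"
  obtains p2 where "0 \<notin> set_pmf p2" "bind_pmf p (\<lambda>k. sum_iid_pmf k B) = bind_pmf B (\<lambda>b. sum_iid_pmf b p2)"
    "\<And>s. 0 \<le> s \<Longrightarrow> s \<le> 1 \<Longrightarrow> (1 - q) * pgf p2 s = pgf p (q + (1 - q) * s) - q"
proof -
  define t where "t = bind_pmf p (\<lambda>k. sum_iid_pmf k B)"
  have pgf_B: "pgf B s = q + (1 - q) * s" for s
    using q by (simp add: pgf_def B)
  have pgf_t: "pgf t s = pgf p (q + (1 - q) * s)" if "0 \<le> s" "s \<le> 1" for s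
    using pgf_compound[OF that] by (simp add: t_def pgf_B)
  have t0: "pmf t 0 = q" using pgf_t[of 0] q by (simp add: pgf_0)
  have "- {0} = {0 :: nat<..}" by auto
  then have pos: "measure t {0<..} = 1 - q"
    using measure_pmf.prob_compl[of "{0}" t] by (simp add: t0 measure_pmf_single Compl_eq_Diff_UNIV)
  then have ne: "set_pmf t \<inter> {0<..} \<noteq> {}"
    using q by (metis diff_gt_0_iff_gt less_irrefl measure_pmf_zero_iff)
  \<comment> \<open>Number of surviving children, given that there is one. As \<open>t\<close> has
    mass \<open>q\<close> at 0, the same as \<open>B\<close>, mixing \<open>p2\<close> with the
    point mass at 0 according to \<open>B\<close> gives back \<open>t\<close>.\<close>
  define p2 where "p2 = cond_pmf t {0<..}"
  have t: "t = bind_pmf B (\<lambda>b. sum_iid_pmf b p2)"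
  proof (rule pmf_eqI)
    fix k
    have "pmf (bind_pmf B (\<lambda>b. sum_iid_pmf b p2)) k = q * pmf (return_pmf 0) k + (1 - q) * pmf p2 k"
      using q by (simp add: B bind_map_pmf pmf_bind sum_iid_pmf_0 sum_iid_pmf_1)
    then show "pmf t k = pmf (bind_pmf B (\<lambda>b. sum_iid_pmf b p2)) k"
      using q t0 pos ne by (cases k) (simp_all add: p2_def pmf_cond)
  qed
  show thesis
  proof (rule that)
    show "0 \<notin> set_pmf p2" using ne by (simp add: p2_def)
    show "bind_pmf p (\<lambda>k. sum_iid_pmf k B) = bind_pmf B (\<lambda>b. sum_iid_pmf b p2)"
      using t by (simp add: t_def)
    fix s :: real assume s: "0 \<le> s" "s \<le> 1"
    have "pgf t s = measure_pmf.expectation B (\<lambda>b. pgf p2 s ^ b)"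
      by (subst t) (simp add: pgf_bind[OF s] pgf_sum_iid[OF s])
    also have "\<dots> = q + (1 - q) * pgf p2 s" using q by (simp add: B)
    finally show "(1 - q) * pgf p2 s = pgf p (q + (1 - q) * s) - q"
      using pgf_t[OF s] by simp
  qed
qed

text \<open>If the mean were at most 1, Bernoulli's inequality
  \<open>s ^ k \<ge> 1 - (1 - s) * k\<close> would integrate to
  \<open>pgf p s \<ge> s\<close>.\<close>

lemma supercriticalI:
  assumes "0 \<le> s" "s \<le> 1" "pgf p s < s"
  shows "supercritical p"
proof (rule ccontr)
  assume "\<not> supercritical p"
  then have m: "(\<integral>\<^sup>+k. ennreal (real k) \<partial>p) \<le> 1"
    by (simp add: supercritical_def ennreal_of_nat_eq_real_of_nat)
  then have int: "integrable p real"
    by (intro integrableI_nonneg) (auto simp: top_unique intro: le_less_trans)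
  have "ennreal (measure_pmf.expectation p real) \<le> ennreal 1"
    using m by (subst nn_integral_eq_integral[symmetric]) (auto simp: int)
  then have m1: "measure_pmf.expectation p real \<le> 1" by simp
  have "1 - (1 - s) * measure_pmf.expectation p real = measure_pmf.expectation p (\<lambda>k. 1 - (1 - s) * real k)"
    using int by simp
  also have "\<dots> \<le> pgf p s"
    unfolding pgf_def
  proof (rule integral_mono)
    show "1 - (1 - s) * real k \<le> s ^ k" for k
      using Bernoulli_inequality[of "s - 1" k] assms by (simp add: algebra_simps)
  qed (use int integrable_pmf_power assms in auto)
  finally have "1 - (1 - s) * measure_pmf.expectation p real < s" using assms by simp
  moreover have "(1 - s) * measure_pmf.expectation p real \<le> (1 - s) * 1"
    using m1 assms by (intro mult_left_mono) auto
  ultimately show False by simp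
qed

section \<open>Power-fractional laws\<close>

lemma powr_inverse_cancel:
  fixes x \<theta> :: real
  assumes "0 < x" "\<theta> \<noteq> 0"
  shows "(x powr (- 1 / \<theta>)) powr \<theta> = inverse x" "(x powr \<theta>) powr (- 1 / \<theta>) = inverse x"
  unfolding powr_powr using assms by (simp_all add: powr_minus)

lemma pgf_PF3:
  assumes "is_PF3 \<theta> a b p" "0 \<le> s" "s < 1"
  shows "pgf p s = 1 - (a / (1 - s) powr \<theta> + b) powr (- 1 / \<theta>)"
  using assms pgf_sums[of s p] by (auto simp: is_PF_def dest: sums_unique2)

text \<open>In the coordinate \<open>x = (1 - s) powr (- \<theta>)\<close> the generating function is the affine map
  \<open>x \<mapsto> a x + b\<close>, whose iterates are explicit.\<close>
lemma pgf_PF3_iterates: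
  assumes \<theta>: "0 < \<theta>" and a: "0 < a" "a < 1" and b: "b > 1 - a" and p: "is_PF3 \<theta> a b p"
  defines "x \<equiv> \<lambda>n. b / (1 - a) + a ^ n * (1 - b / (1 - a))"
  shows "(pgf p ^^ n) 0 = 1 - x n powr (- 1 / \<theta>)"
proof (induction n)
  case 0
  \<comment> \<open>\<open>x 0 = 1\<close> is the coordinate of \<open>s = 0\<close>;
    \<open>b / (1 - a)\<close> is the fixed point of the affine map.\<close>
  show ?case by (simp add: x_def)
next
  case (Suc n)
  have c: "b / (1 - a) > 1" using a b by simp
  \<comment> \<open>The bound \<open>x n \<ge> 1\<close> keeps the iterate in \<open>[0, 1)\<close>,
    where the formula for the generating function is available.\<close>
  have "x n - 1 = (1 - a ^ n) * (b / (1 - a) - 1)" unfolding x_def by algebra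
  also have "\<dots> \<ge> 0" using a c by (intro mult_nonneg_nonneg) (auto simp: power_le_one)
  finally have x1: "x n \<ge> 1" by simp
  then have "x n powr (- 1 / \<theta>) \<le> x n powr 0" using \<theta> by (intro powr_mono) auto
  then have le: "x n powr (- 1 / \<theta>) \<le> 1" "0 < x n powr (- 1 / \<theta>)" using x1 by auto
  have "b = (1 - a) * (b / (1 - a))" using a by simp
  moreover have "x (Suc n) = a * x n + (1 - a) * (b / (1 - a))"
    unfolding x_def by (simp only: power_Suc) algebra
  ultimately have "x (Suc n) = a * x n + b" by (simp only:)
  then show ?case
    using pgf_PF3[OF p, of "1 - x n powr (- 1 / \<theta>)"] le x1 \<theta> powr_inverse_cancel(1)[of "x n" \<theta>]
    by (simp add: Suc divide_inverse)
qed

section \<open>The root \<open>q\<close> and the two conditioned offspring laws\<close>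

context
  fixes \<theta> a b q :: real
  assumes \<theta>: "0 < \<theta>" and a: "0 < a" "a < 1" and b: "b > 1 - a"
    and q: "q = 1 - ((1 - a) / b) powr (1 / \<theta>)"
begin

lemma PF3_extinction_root: "0 < q" "q < 1" "(1 - q) powr \<theta> = (1 - a) / b"
proof -
  have r: "0 < (1 - a) / b" "(1 - a) / b < 1" using a b by auto
  then have "((1 - a) / b) powr (1 / \<theta>) < 1 powr (1 / \<theta>)"
    using \<theta> by (intro powr_less_mono2) auto
  then show "0 < q" "q < 1" using r a b by (auto simp: q)
  show "(1 - q) powr \<theta> = (1 - a) / b" using r \<theta> a b by (simp add: q powr_powr abs_of_pos)
qed

text \<open>Translates the fixed point of the affine map back into the variable \<open>s\<close>: it
  is the coordinate of \<open>q\<close>.\<close>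

lemma PF3_fixed_point: "(b / (1 - a)) powr (- 1 / \<theta>) = 1 - q"
proof -
  have "b / (1 - a) = inverse ((1 - a) / b)" by simp
  also have "\<dots> powr (- 1 / \<theta>) = ((1 - a) / b) powr (1 / \<theta>)"
    using a b by (simp add: inverse_powr powr_minus[symmetric] del: inverse_divide)
  finally show ?thesis by (simp add: q)
qed

lemma pgf_PF3_root:
  assumes "is_PF3 \<theta> a b p"
  shows "pgf p q = q"
proof -
  have "a / (1 - q) powr \<theta> + b = b / (1 - a)"
    using a b by (simp add: PF3_extinction_root field_simps)
  then show ?thesis
    using pgf_PF3[OF assms, of q] PF3_extinction_root PF3_fixed_point by simp
qed

lemma pgf_PF3_iterates_tendsto:
  assumes "is_PF3 \<theta> a b p"
  shows "(\<lambda>n. (pgf p ^^ n) 0) \<longlonglongrightarrow> q"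
proof -
  have "(\<lambda>n. a ^ n) \<longlonglongrightarrow> 0" using a by (intro LIMSEQ_realpow_zero) auto
  then have "(\<lambda>n. b / (1 - a) + a ^ n * (1 - b / (1 - a))) \<longlonglongrightarrow> b / (1 - a) + 0 * (1 - b / (1 - a))"
    by (intro tendsto_add tendsto_mult tendsto_const)
  then have "(\<lambda>n. 1 - (b / (1 - a) + a ^ n * (1 - b / (1 - a))) powr (- 1 / \<theta>))
      \<longlonglongrightarrow> 1 - (b / (1 - a)) powr (- 1 / \<theta>)"
    using a b by (intro tendsto_diff tendsto_powr tendsto_const) auto
  then show ?thesis
    using pgf_PF3_iterates[OF \<theta> a b assms] PF3_fixed_point by simp
qed

text \<open>To the right of \<open>q\<close> the coordinate \<open>x\<close> exceeds the fixed
  point, and the slope \<open>a < 1\<close> gives \<open>a * x + b < x\<close>; returning to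
  \<open>s\<close> preserves the order.\<close>

lemma pgf_PF3_less:
  assumes "is_PF3 \<theta> a b p" "q < s" "s < 1"
  shows "pgf p s < s"
proof -
  have s0: "0 < s" using assms PF3_extinction_root by simp
  have "(1 - s) powr \<theta> < (1 - q) powr \<theta>"
    using assms \<theta> by (intro powr_less_mono2) auto
  then have "b * (1 - s) powr \<theta> < 1 - a"
    using a b by (simp add: PF3_extinction_root field_simps)
  then have "(a + b * (1 - s) powr \<theta>) / (1 - s) powr \<theta> < 1 / (1 - s) powr \<theta>"
    using assms by (intro divide_strict_right_mono) auto
  moreover have "a / (1 - s) powr \<theta> + b = (a + b * (1 - s) powr \<theta>) / (1 - s) powr \<theta>"
    using assms by (simp add: add_divide_distrib)
  ultimately have "a / (1 - s) powr \<theta> + b < inverse ((1 - s) powr \<theta>)"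
    by (simp only: inverse_eq_divide)
  moreover have "0 < a / (1 - s) powr \<theta> + b" using a b by (simp add: add_nonneg_pos)
  ultimately have "inverse ((1 - s) powr \<theta>) powr (- 1 / \<theta>) < (a / (1 - s) powr \<theta> + b) powr (- 1 / \<theta>)"
    using \<theta> by (intro powr_less_mono2_neg) auto
  moreover have "inverse ((1 - s) powr \<theta>) powr (- 1 / \<theta>) = 1 - s"
    using assms \<theta> by (simp add: powr_minus[symmetric] powr_powr)
  ultimately show ?thesis using pgf_PF3[OF assms(1), of s] assms s0 by simp
qed

lemma PF3_pos_0:
  assumes "is_PF3 \<theta> a b p"
  shows "0 < pmf p 0"
proof -
  have "(a + b) powr (- 1 / \<theta>) < (a + b) powr 0"
    using \<theta> b by (intro powr_less_mono) auto
  then show ?thesis using pgf_PF3[OF assms, of 0] b a by (simp add: pgf_0)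
qed

text \<open>Writing \<open>1 - q * s = q * (inverse q - s)\<close> pulls a power of \<open>q\<close>
  out of the formula for \<open>pgf p (q * s) / q\<close>: the shift becomes
  \<open>inverse q\<close>, \<open>b\<close> gains the factor \<open>q powr \<theta>\<close> and
  \<open>a\<close> is unchanged.\<close>

lemma is_PF_finite_progeny:
  assumes "\<theta> \<le> 1" "is_PF3 \<theta> a b p" and p1: "\<And>k. q * pmf p1 k = pmf p k * q ^ k"
  shows "is_PF \<theta> (inverse q) a (b * q powr \<theta>) p1"
  unfolding is_PF_def
proof (intro conjI allI impI)
  note root = PF3_extinction_root
  \<comment> \<open>The upper bound in \<open>PF_admissible\<close> is attained with equality: this
    is the case without defect, in which the generating function is 1 at
    \<open>s = 1\<close>.\<close>
  have "inverse q - 1 = (1 - q) / q" using root by (simp add: field_simps)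
  then have "(inverse q - 1) powr (- \<theta>) = inverse ((1 - q) powr \<theta> / q powr \<theta>)"
    using root by (simp only:) (simp add: powr_divide powr_minus)
  then have "(inverse q - 1) powr (- \<theta>) = b * q powr \<theta> / (1 - a)"
    by (simp add: root(3))
  moreover have "inverse q powr (- \<theta>) = q powr \<theta>"
    using root by (simp add: inverse_powr powr_minus)
  moreover have "q powr \<theta> * 1 \<le> q powr \<theta> * (b / (1 - a))"
    using a b by (intro mult_left_mono) auto
  ultimately show "PF_admissible \<theta> (inverse q) a (b * q powr \<theta>)"
    using \<theta> assms(1) a b root by (auto simp: PF_admissible_def field_simps)
  fix s assume s: "0 \<le> s \<and> s < inverse q"
  \<comment> \<open>Here \<open>s\<close> may exceed 1, but the series of \<open>p\<close> is
    evaluated only at \<open>q * s < 1\<close>.\<close>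
  then have qs: "0 \<le> q * s" "q * s < 1" using root by (auto simp: field_simps)
  have "pmf p k * (q * s) ^ k / q = pmf p1 k * s ^ k" for k
    using p1[of k] root by (simp add: power_mult_distrib field_simps)
  then have sums: "(\<lambda>k. pmf p1 k * s ^ k) sums (pgf p (q * s) / q)"
    using sums_divide[OF pgf_sums[of "q * s" p], of q] qs by simp
  let ?X = "a / (1 - q * s) powr \<theta> + b"
  have X: "0 < ?X" using a b by (simp add: add_nonneg_pos)
  have "inverse q - s = (1 - q * s) / q" using root by (simp add: field_simps)
  then have "(inverse q - s) powr \<theta> = (1 - q * s) powr \<theta> / q powr \<theta>"
    using root qs by (simp only:) (simp add: powr_divide)
  then have "a / (inverse q - s) powr \<theta> + b * q powr \<theta> = q powr \<theta> * ?X"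
    by (simp add: algebra_simps)
  then have "(a / (inverse q - s) powr \<theta> + b * q powr \<theta>) powr (- 1 / \<theta>) = inverse q * ?X powr (- 1 / \<theta>)"
    using X root \<theta> powr_inverse_cancel(2)[of q \<theta>] by (simp add: powr_mult)
  then show "(\<lambda>k. pmf p1 k * s ^ k) sums
      (inverse q - (a / (inverse q - s) powr \<theta> + b * q powr \<theta>) powr (- 1 / \<theta>))"
    using sums pgf_PF3[OF assms(2) qs] by (simp add: right_diff_distrib divide_inverse mult.commute)
qed

text \<open>Since \<open>1 - (q + (1 - q) * s) = (1 - q) * (1 - s)\<close>, the substitution
  multiplies the coordinate by the fixed point \<open>b / (1 - a)\<close>. Dividing the affine map
  by it moves the fixed point to 1 and leaves \<open>x \<mapsto> a * x + (1 - a)\<close>.\<close>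

lemma is_PF_plus_infinite_line:
  assumes "\<theta> \<le> 1" "is_PF3 \<theta> a b p"
    and p2: "\<And>s. 0 \<le> s \<Longrightarrow> s \<le> 1 \<Longrightarrow> (1 - q) * pgf p2 s = pgf p (q + (1 - q) * s) - q"
  shows "is_PF_plus \<theta> a p2"
  unfolding is_PF_plus_def is_PF_def
proof (intro conjI allI impI)
  note root = PF3_extinction_root
  show "a < 1" by (rule a)
  show "PF_admissible \<theta> 1 a (1 - a)" using \<theta> assms(1) a by (simp add: PF_admissible_def)
  fix s :: real assume s: "0 \<le> s \<and> s < 1"
  let ?Y = "a / (1 - s) powr \<theta> + (1 - a)" and ?u = "q + (1 - q) * s"
  have Y: "0 < ?Y" using a by (simp add: add_nonneg_pos)
  have u: "1 - ?u = (1 - q) * (1 - s)" by (simp add: algebra_simps)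
  then have "1 - ?u > 0" using root s by (simp only: zero_less_mult_iff) simp
  moreover have "0 \<le> ?u" using root s by simp
  moreover have "a / (1 - ?u) powr \<theta> + b = b / (1 - a) * ?Y"
    unfolding u using root s a b by (simp add: powr_mult) (simp add: field_simps)
  moreover have "(b / (1 - a) * ?Y) powr (- 1 / \<theta>) = (1 - q) * ?Y powr (- 1 / \<theta>)"
    using Y a b by (subst powr_mult) (simp_all only: PF3_fixed_point)
  ultimately have "pgf p ?u = 1 - (1 - q) * ?Y powr (- 1 / \<theta>)"
    using pgf_PF3[OF assms(2), of ?u] by simp
  then have "(1 - q) * pgf p2 s = (1 - q) * (1 - ?Y powr (- 1 / \<theta>))"
    using p2[of s] s by (simp only: right_diff_distrib) simp
  then have "pgf p2 s = 1 - ?Y powr (- 1 / \<theta>)" using root by simp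
  then show "(\<lambda>k. pmf p2 k * s ^ k) sums (1 - (a / (1 - s) powr \<theta> + (1 - a)) powr (- 1 / \<theta>))"
    using pgf_sums[of s p2] s by simp
qed

end

theorem theorem7p1:
  fixes M :: "'w measure" and \<xi> :: "nat list \<Rightarrow> 'w \<Rightarrow> nat"
    and p :: "nat pmf" and \<theta> a b q :: real
  assumes "0 < \<theta>" and "\<theta> \<le> 1" and "0 < a" and "a < 1" and "b > 1 - a"
    and "is_PF3 \<theta> a b p"
    and "gw_family M \<xi> p"
    and "q = 1 - ((1 - a) / b) powr (1 / \<theta>)"
  shows "supercritical p
    \<and> 0 < q \<and> q < 1 \<and> measure M (extinction M \<xi>) = q
    \<and> (\<exists>p1. is_PF \<theta> (inverse q) a (b * q powr \<theta>) p1
          \<and> galton_watson (uniform_measure M (extinction M \<xi>)) (gw_Z1 \<xi>) p1)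
    \<and> (\<exists>p2. is_PF_plus \<theta> a p2
          \<and> galton_watson (uniform_measure M (explosion M \<xi>)) (gw_Z2 \<xi>) p2)"
proof -
  note params = assms(1,3,4,5,8) and p = assms(6) and \<xi> = assms(7)
  note root = PF3_extinction_root[OF params]
  note lim = pgf_PF3_iterates_tendsto[OF params p]
  note fix_q = pgf_PF3_root[OF params p]
  \<comment> \<open>The midpoint of \<open>q\<close> and 1 serves as a point where the generating
    function lies below the diagonal.\<close>
  have "supercritical p"
    using root pgf_PF3_less[OF params p, of "(1 + q) / 2"]
    by (intro supercriticalI[of "(1 + q) / 2"]) simp_all
  moreover have "measure M (extinction M \<xi>) = q" by (rule extinction_prob[OF \<xi> lim])
  moreover obtain p1 where p1: "\<And>k. q * pmf p1 k = pmf p k * q ^ k"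
    using finite_progeny_offspring_law[OF root(1) less_imp_le[OF root(2)] fix_q] by blast
  then have "is_PF \<theta> (inverse q) a (b * q powr \<theta>) p1
      \<and> galton_watson (uniform_measure M (extinction M \<xi>)) (gw_Z1 \<xi>) p1"
    using is_PF_finite_progeny[OF params assms(2) p p1]
      galton_watson_Z1[OF \<xi> lim root(1) less_imp_le[OF root(2)] p1] by blast
  moreover obtain p2 where p2: "0 \<notin> set_pmf p2"
      "bind_pmf p (\<lambda>k. sum_iid_pmf k (map_pmf (\<lambda>b. of_bool (\<not> b)) (bernoulli_pmf q)))
        = bind_pmf (map_pmf (\<lambda>b. of_bool (\<not> b)) (bernoulli_pmf q)) (\<lambda>b. sum_iid_pmf b p2)"
      "\<And>s. 0 \<le> s \<Longrightarrow> s \<le> 1 \<Longrightarrow> (1 - q) * pgf p2 s = pgf p (q + (1 - q) * s) - q"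
    using infinite_line_offspring_law[OF less_imp_le[OF root(1)] root(2) fix_q refl] by blast
  then have "is_PF_plus \<theta> a p2 \<and> galton_watson (uniform_measure M (explosion M \<xi>)) (gw_Z2 \<xi>) p2"
    using is_PF_plus_infinite_line[OF params assms(2) p p2(3)]
      galton_watson_Z2[OF \<xi> lim less_imp_le[OF root(1)] root(2) PF3_pos_0[OF params p] refl p2(1,2)] by blast
  ultimately show ?thesis using root(1,2) by blast
qed

end
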